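(* Assume (A1) and (A2). Consider the M-CRM (Algorithm 1) run with exact gradients ($\nabla\bar F_j=\nabla F_j$, $\bar\kappa_G=0$) and, at outer iteration $t$ and inner iteration $i$, with $\nabla^2\bar F_j(x_t)=\frac12(A_j+A_j^T)$, where $A_j\in\mathbb R^{n\times n}$ is the finite-difference matrix whose $l$-th column ($l=1,\dots,n$) is, with $x=x_t$, one of $$\frac{\nabla F_j(x+he_l)-\nabla F_j(x)}{h},\quad \frac{\nabla F_j(x)-\nabla F_j(x-he_l)}{h},\quad \frac{\nabla F_j(x+he_l)-\nabla F_j(x-he_l)}{2h}$$ (the same choice for all columns), with $h=2\|x_t-x_{t-1}\|/(n^\beta\alpha^{i-1})$ and $\beta\in[0,1/2]$; here $x_t\ne x_{t-1}$ for all $t$, so that $h>0$. Then the M-CRM requires at most $\mathcal O\big(n^{3(1-2\beta)/4}\varepsilon^{-3/2}\big)$ (outer) iterations to generate an $\varepsilon$-approximate Pareto critical point of $\min_{x\in\mathbb R^n}F(x)$, and the total number of evaluations of the functions $F_j$ and gradients $\nabla F_j$ required to generate such a point is $\mathcal O\big(m\,n^{(7-6\beta)/4}\varepsilon^{-3/2}\big)$.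
   Context: Setting: $F=(F_1,\dots,F_m):\mathbb R^n\to\mathbb R^m$ is twice continuously differentiable, $\mathcal J=\{1,\dots,m\}$; $\|\cdot\|$ is the Euclidean norm and the induced operator norm; $e_l$ is the $l$-th canonical basis vector. (A1): for every $j\in\mathcal J$, $\|\nabla^2F_j(y)-\nabla^2F_j(z)\|\le L_j\|y-z\|$ for all $y,z\in\mathbb R^n$; $L:=\max_{j}L_j$. (A2): for every $j\in\mathcal J$ there is $F_j^*\in\mathbb R$ with $F_j(y)\ge F_j^*$ for all $y\in\mathbb R^n$. A point $\bar x$ is an $\varepsilon$-approximate Pareto critical point if there is $\bar\lambda\in\mathbb R^m_+$ with $\sum_j\bar\lambda_j=1$ and $\|\sum_j\bar\lambda_j\nabla F_j(\bar x)\|\le\varepsilon$. Given approximations $\nabla\bar F_j(x)$ of $\nabla F_j(x)$ and symmetric $\nabla^2\bar F_j(x)$ of $\nabla^2F_j(x)$, and $\sigma>0$, set $$M^j_{x,\sigma}(y):=\langle\nabla\bar F_j(x),y-x\rangle+\tfrac12\langle\nabla^2\bar F_j(x)(y-x),y-x\rangle+\tfrac{\sigma}{6}\|y-x\|^3,\qquad M_{x,\sigma}(y):=\max_{j\in\mathcal J}M^j_{x,\sigma}(y).$$ Algorithm 1 (M-CRM), with derivative approximations chosen as in the claim. Step 0: choose $x_0,x_1\in\mathbb R^n$, $\sigma_1>0$, $\theta\ge0$, $\alpha>1$; set $t:=1$. Step 1: let $i\ge0$ be the smallest integer with $\alpha^{i-1}\sigma_t\ge\sigma_1$. Step 1.1: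 for every $j$ compute $\nabla\bar F_j(x_t),\nabla^2\bar F_j(x_t)$ (for the current $i$). Step 1.2: compute $(x^+_{t,i},\lambda^+_{t,i})\in\mathbb R^n\times\mathbb R^m_+$ with $M_{x_t,\alpha^i\sigma_t}(x^+_{t,i})\le0$, $\sum_j(\lambda^+_{t,i})_j=1$, and $\big\|\sum_j(\lambda^+_{t,i})_j\nabla M^j_{x_t,\alpha^i\sigma_t}(x^+_{t,i})\big\|\le\theta\|x^+_{t,i}-x_t\|^2$. Step 1.3: if $F_j(x_t)-F_j(x^+_{t,i})\ge\frac{\alpha^i\sigma_t}{12}\|x^+_{t,i}-x_t\|^3-\frac{\sigma_t}{12}\|x_t-x_{t-1}\|^3$ for all $j\in\mathcal J$, set $i_t=i$ and go to Step 2; otherwise set $i:=i+1$ and go to Step 1.1. Step 2: set $x_{t+1}=x^+_{t,i_t}$, $\lambda_{t+1}=\lambda^+_{t,i_t}$, $\sigma_{t+1}=\alpha^{i_t-1}\sigma_t$, $t:=t+1$, and go to Step 1. Outer iterations are indexed by $t$. Each inner iteration (Steps 1.1–1.3 for one value of $i$) uses $\mathcal O(nm)$ evaluations of functions $F_j$ and gradients $\nabla F_j$. The $\mathcal O(\cdot)$ bounds are for $\varepsilon\in(0,1]$, with implied constants depending only on $L$, $\theta$, $\sigma_1$, $\alpha$, $\min_j[F_j(x_1)-F_j^*]$ and $\|x_1-x_0\|$ (not on $n,m,\varepsilon$). *)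

theory Defs
  imports "HOL-Analysis.Analysis"
begin

section \<open>Euclidean spaces of variable dimension\<close>

text \<open>
  The constants hidden in the complexity bounds must not depend on the dimension \<open>n\<close>, so
  \<open>n\<close> has to be quantified \<^emph>\<open>inside\<close> the theorem, below the constants. A type-indexed space
  such as \<open>real ^ 'n\<close> does not permit this. Therefore \<open>\<real>\<^sup>n\<close> is the subspace of those vectors of
  the inner product space of finitely supported real sequences that vanish from index \<open>n\<close> on.
  It carries the standard inner product and the Euclidean norm. Coordinates and the indices of
  the objective functions are counted from 0.
\<close>

typedef evec = "{f :: nat \<Rightarrow> real. finite {i. f i \<noteq> 0}}"
  morphisms coord Abs_evec
  by (rule exI[of _ "\<lambda>_. 0"]) simp

lemma finite_coord [simp]: "finite {i. coord x i \<noteq> 0}"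
  using coord[of x] by simp

lemma evec_eqI: "(\<And>i. coord x i = coord y i) \<Longrightarrow> x = y"
  by (metis coord_inject ext)

lemma coord_Abs: "finite {i. f i \<noteq> 0} \<Longrightarrow> coord (Abs_evec f) = f"
  by (simp add: Abs_evec_inverse)

instantiation evec :: real_vector
begin

definition zero_evec where "0 = Abs_evec (\<lambda>_. 0)"
definition plus_evec where "x + y = Abs_evec (\<lambda>i. coord x i + coord y i)"
definition minus_evec where "x - y = Abs_evec (\<lambda>i. coord x i - coord y i)"
definition uminus_evec where "- x = Abs_evec (\<lambda>i. - coord x i)"
definition scaleR_evec where "r *\<^sub>R x = Abs_evec (\<lambda>i. r * coord x i)"

lemma coord_zero [simp]: "coord 0 i = 0"
  by (simp add: zero_evec_def coord_Abs)

lemma coord_add [simp]: "coord (x + y) i = coord x i + coord y i"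
proof -
  have "finite {i. coord x i + coord y i \<noteq> 0}"
    by (rule finite_subset[of _ "{i. coord x i \<noteq> 0} \<union> {i. coord y i \<noteq> 0}"]) auto
  then show ?thesis by (simp add: plus_evec_def coord_Abs)
qed

lemma coord_diff [simp]: "coord (x - y) i = coord x i - coord y i"
proof -
  have "finite {i. coord x i - coord y i \<noteq> 0}"
    by (rule finite_subset[of _ "{i. coord x i \<noteq> 0} \<union> {i. coord y i \<noteq> 0}"]) auto
  then show ?thesis by (simp add: minus_evec_def coord_Abs)
qed

lemma coord_uminus [simp]: "coord (- x) i = - coord x i"
  by (simp add: uminus_evec_def coord_Abs)

lemma coord_scaleR [simp]: "coord (r *\<^sub>R x) i = r * coord x i"
proof -
  have "finite {i. r * coord x i \<noteq> 0}"
    by (rule finite_subset[of _ "{i. coord x i \<noteq> 0}"]) auto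
  then show ?thesis by (simp add: scaleR_evec_def coord_Abs)
qed

instance
  by standard (auto intro!: evec_eqI simp: algebra_simps)

end

instantiation evec :: real_inner
begin

definition inner_evec where "x \<bullet> y = (\<Sum>i | coord x i \<noteq> 0. coord x i * coord y i)"
definition norm_evec where "norm (x :: evec) = sqrt (x \<bullet> x)"
definition dist_evec where "dist (x :: evec) y = norm (x - y)"
definition sgn_evec where "sgn (x :: evec) = x /\<^sub>R norm x"
definition uniformity_evec where
  "(uniformity :: (evec \<times> evec) filter) = (INF e\<in>{0 <..}. principal {(x, y). dist x y < e})"
definition open_evec where
  "open (U :: evec set) = (\<forall>x\<in>U. \<forall>\<^sub>F (x', y) in uniformity. x' = x \<longrightarrow> y \<in> U)"

lemma inner_evec_eq_sum:
  assumes "finite A" "{i. coord x i \<noteq> 0} \<subseteq> A \<or> {i. coord y i \<noteq> 0} \<subseteq> A"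
  shows "x \<bullet> y = (\<Sum>i\<in>A. coord x i * coord y i)"
proof -
  let ?B = "A \<union> {i. coord x i \<noteq> 0}"
  have "x \<bullet> y = (\<Sum>i\<in>?B. coord x i * coord y i)"
    unfolding inner_evec_def using assms(1) by (intro sum.mono_neutral_left) auto
  also have "\<dots> = (\<Sum>i\<in>A. coord x i * coord y i)"
    using assms by (intro sum.mono_neutral_right) auto
  finally show ?thesis .
qed

instance
proof
  fix x y z :: evec and r :: real
  show "dist x y = norm (x - y)" by (rule dist_evec_def)
  show "sgn x = x /\<^sub>R norm x" by (rule sgn_evec_def)
  show "uniformity = (INF e\<in>{0 <..}. principal {(x :: evec, y). dist x y < e})"
    by (rule uniformity_evec_def)
  show "open U = (\<forall>x\<in>U. \<forall>\<^sub>F (x', y) in uniformity. x' = x \<longrightarrow> y \<in> U)" for U :: "evec set"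
    by (rule open_evec_def)
  show "norm x = sqrt (x \<bullet> x)" by (rule norm_evec_def)
  let ?A = "{i. coord x i \<noteq> 0} \<union> {i. coord y i \<noteq> 0}"
  show "x \<bullet> y = y \<bullet> x"
    by (simp add: inner_evec_eq_sum[of ?A] mult.commute)
  have "{i. coord (x + y) i \<noteq> 0} \<subseteq> ?A" by auto
  then show "(x + y) \<bullet> z = x \<bullet> z + y \<bullet> z"
    by (simp add: inner_evec_eq_sum[of ?A] algebra_simps sum.distrib)
  have "{i. coord (r *\<^sub>R x) i \<noteq> 0} \<subseteq> {i. coord x i \<noteq> 0}" by auto
  then show "r *\<^sub>R x \<bullet> y = r * (x \<bullet> y)"
    by (simp add: inner_evec_eq_sum[of "{i. coord x i \<noteq> 0}"] algebra_simps sum_distrib_left)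
  show "0 \<le> x \<bullet> x"
    by (simp add: inner_evec_def sum_nonneg)
  show "x \<bullet> x = 0 \<longleftrightarrow> x = 0"
    by (auto simp: inner_evec_def sum_nonneg_eq_0_iff intro: evec_eqI)
qed

end

definition Rn :: "nat \<Rightarrow> evec set" where
  "Rn n = {x. \<forall>i\<ge>n. coord x i = 0}"

definition basis_vec :: "nat \<Rightarrow> evec" where
  "basis_vec l = Abs_evec (\<lambda>i. if i = l then 1 else 0)"

lemma coord_basis_vec [simp]: "coord (basis_vec l) i = (if i = l then 1 else 0)"
  by (simp add: basis_vec_def coord_Abs)

text \<open>
  Only the entries with both indices below \<open>n\<close> of an \<open>n \<times> n\<close> matrix are relevant.
\<close>

type_synonym matrix = "nat \<Rightarrow> nat \<Rightarrow> real"

definition mat_vec :: "nat \<Rightarrow> matrix \<Rightarrow> evec \<Rightarrow> evec" where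
  "mat_vec n A v = (\<Sum>i<n. (\<Sum>k<n. A i k * coord v k) *\<^sub>R basis_vec i)"

text \<open>
  The map \<open>mat_vec n A\<close> factors through the orthogonal projection onto \<open>Rn n\<close>, so its
  \<open>onorm\<close> over the whole type is the operator norm on \<open>\<real>\<^sup>n\<close>.
\<close>

definition mat_dist :: "nat \<Rightarrow> matrix \<Rightarrow> matrix \<Rightarrow> real" where
  "mat_dist n A B = onorm (mat_vec n (\<lambda>i k. A i k - B i k))"


section \<open>Derivatives on \<open>\<real>\<^sup>n\<close>\<close>

text \<open>
  A function on \<open>\<real>\<^sup>n\<close> is represented by a function on \<open>evec\<close> of which only the values on
  \<open>Rn n\<close> matter; accordingly all derivatives are taken within \<open>Rn n\<close>.
\<close>

definition grad :: "nat \<Rightarrow> (evec \<Rightarrow> real) \<Rightarrow> evec \<Rightarrow> evec" where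
  "grad n f x = (THE g. g \<in> Rn n \<and> (f has_derivative (\<lambda>v. g \<bullet> v)) (at x within Rn n))"

definition hess :: "nat \<Rightarrow> (evec \<Rightarrow> real) \<Rightarrow> evec \<Rightarrow> matrix" where
  "hess n f x = (\<lambda>i k. coord (grad n (\<lambda>y. coord (grad n f y) i) x) k)"

definition C2_on_Rn :: "nat \<Rightarrow> (evec \<Rightarrow> real) \<Rightarrow> bool" where
  "C2_on_Rn n f \<longleftrightarrow>
     f differentiable_on Rn n \<and>
     (\<forall>i<n. (\<lambda>y. coord (grad n f y) i) differentiable_on Rn n) \<and>
     (\<forall>i<n. \<forall>k<n. continuous_on (Rn n) (\<lambda>y. hess n f y i k))"

lemma grad_eqI:
  assumes x: "x \<in> Rn n" and g: "g \<in> Rn n"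
    and der: "(f has_derivative (\<lambda>v. g \<bullet> v)) (at x within Rn n)"
  shows "grad n f x = g"
  unfolding grad_def
proof (rule the_equality)
  show "g \<in> Rn n \<and> (f has_derivative (\<lambda>v. g \<bullet> v)) (at x within Rn n)"
    using g der by simp
next
  fix g' assume g': "g' \<in> Rn n \<and> (f has_derivative (\<lambda>v. g' \<bullet> v)) (at x within Rn n)"
  have path: "((\<lambda>t :: real. x + t *\<^sub>R v) has_derivative (\<lambda>t. t *\<^sub>R v)) (at 0)" for v
    by (auto intro!: derivative_eq_intros)
  have along: "((\<lambda>t. f (x + t *\<^sub>R v)) has_derivative (\<lambda>t. w \<bullet> (t *\<^sub>R v))) (at 0)"
    if "v \<in> Rn n" and "(f has_derivative (\<lambda>v. w \<bullet> v)) (at x within Rn n)" for v w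
  proof -
    have "range (\<lambda>t :: real. x + t *\<^sub>R v) \<subseteq> Rn n"
      using x that(1) by (auto simp: Rn_def)
    then have "(f has_derivative (\<lambda>v. w \<bullet> v)) (at (x + 0 *\<^sub>R v) within range (\<lambda>t. x + t *\<^sub>R v))"
      using that(2) by (auto intro: has_derivative_subset)
    from has_derivative_in_compose[OF path this]
    show "((\<lambda>t. f (x + t *\<^sub>R v)) has_derivative (\<lambda>t. w \<bullet> (t *\<^sub>R v))) (at 0)" by simp
  qed
  have "g' - g \<in> Rn n" using g g' by (simp add: Rn_def)
  then have "(\<lambda>t :: real. g' \<bullet> (t *\<^sub>R (g' - g))) = (\<lambda>t. g \<bullet> (t *\<^sub>R (g' - g)))"
    using along der g' has_derivative_unique by blast
  from fun_cong[OF this, of 1] have "(g' - g) \<bullet> (g' - g) = 0"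
    by (simp add: inner_diff_left)
  then show "g' = g" by simp
qed


section \<open>Approximate Pareto criticality\<close>

definition in_simplex :: "nat \<Rightarrow> (nat \<Rightarrow> real) \<Rightarrow> bool" where
  "in_simplex m l \<longleftrightarrow> (\<forall>j<m. 0 \<le> l j) \<and> (\<Sum>j<m. l j) = 1"

definition approx_pareto_critical ::
    "nat \<Rightarrow> nat \<Rightarrow> (nat \<Rightarrow> evec \<Rightarrow> real) \<Rightarrow> real \<Rightarrow> evec \<Rightarrow> bool" where
  "approx_pareto_critical n m F \<epsilon> x \<longleftrightarrow>
     x \<in> Rn n \<and> (\<exists>l. in_simplex m l \<and> norm (\<Sum>j<m. l j *\<^sub>R grad n (F j) x) \<le> \<epsilon>)"


section \<open>The algorithm M-CRM\<close>

definition cubic_model ::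
    "nat \<Rightarrow> evec \<Rightarrow> matrix \<Rightarrow> evec \<Rightarrow> real \<Rightarrow> evec \<Rightarrow> real" where
  "cubic_model n g B x \<sigma> y =
     g \<bullet> (y - x) + 1/2 * (mat_vec n B (y - x) \<bullet> (y - x)) + \<sigma>/6 * norm (y - x) ^ 3"

text \<open>
  One record per inner iteration \<open>(t, i)\<close>: the indices \<open>t\<close> and \<open>i\<close>, the points \<open>x\<^bsub>t-1\<^esub>\<close> and
  \<open>x\<^sub>t\<close>, the parameter \<open>\<sigma>\<^sub>t\<close>, and the pair computed in Step 1.2.
\<close>

record mcrm_iter =
  outer :: nat
  inneridx :: nat
  xprev :: evec
  xcur :: evec
  sigma :: real
  xtrial :: evec
  ltrial :: "nat \<Rightarrow> real"

definition first_inner :: "real \<Rightarrow> real \<Rightarrow> real \<Rightarrow> nat" where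
  "first_inner \<alpha> \<sigma>\<^sub>1 \<sigma> = (LEAST i. \<alpha> powi (int i - 1) * \<sigma> \<ge> \<sigma>\<^sub>1)"

definition trial_ok ::
    "nat \<Rightarrow> nat \<Rightarrow> (mcrm_iter \<Rightarrow> nat \<Rightarrow> evec) \<Rightarrow> (mcrm_iter \<Rightarrow> nat \<Rightarrow> matrix) \<Rightarrow>
     real \<Rightarrow> real \<Rightarrow> mcrm_iter \<Rightarrow> bool" where
  "trial_ok n m gbar Hbar \<theta> \<alpha> s \<longleftrightarrow>
     (let x = xcur s; y = xtrial s;
          M = (\<lambda>j. cubic_model n (gbar s j) (Hbar s j) x (\<alpha> ^ inneridx s * sigma s))
      in y \<in> Rn n \<and>
         Max ((\<lambda>j. M j y) ` {..<m}) \<le> 0 \<and>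
         in_simplex m (ltrial s) \<and>
         norm (\<Sum>j<m. ltrial s j *\<^sub>R grad n (M j) y) \<le> \<theta> * norm (y - x) ^ 2)"

definition accepted :: "nat \<Rightarrow> (nat \<Rightarrow> evec \<Rightarrow> real) \<Rightarrow> real \<Rightarrow> mcrm_iter \<Rightarrow> bool" where
  "accepted m F \<alpha> s \<longleftrightarrow>
     (\<forall>j<m. F j (xcur s) - F j (xtrial s)
        \<ge> \<alpha> ^ inneridx s * sigma s / 12 * norm (xtrial s - xcur s) ^ 3
          - sigma s / 12 * norm (xcur s - xprev s) ^ 3)"

text \<open>
  A run is the sequence of all inner iterations in the order of their execution. That the inner
  loop terminates is not presupposed: a run may remain in one outer iteration forever.
\<close>

definition mcrm_run ::
    "nat \<Rightarrow> nat \<Rightarrow> (nat \<Rightarrow> evec \<Rightarrow> real) \<Rightarrow>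
     (mcrm_iter \<Rightarrow> nat \<Rightarrow> evec) \<Rightarrow> (mcrm_iter \<Rightarrow> nat \<Rightarrow> matrix) \<Rightarrow>
     real \<Rightarrow> real \<Rightarrow> real \<Rightarrow> evec \<Rightarrow> evec \<Rightarrow> (nat \<Rightarrow> mcrm_iter) \<Rightarrow> bool" where
  "mcrm_run n m F gbar Hbar \<theta> \<sigma>\<^sub>1 \<alpha> x\<^sub>0 x\<^sub>1 s \<longleftrightarrow>
     x\<^sub>0 \<in> Rn n \<and> x\<^sub>1 \<in> Rn n \<and> \<sigma>\<^sub>1 > 0 \<and> \<theta> \<ge> 0 \<and> \<alpha> > 1 \<and>
     outer (s 0) = 1 \<and> xprev (s 0) = x\<^sub>0 \<and> xcur (s 0) = x\<^sub>1 \<and> sigma (s 0) = \<sigma>\<^sub>1 \<and>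
     inneridx (s 0) = first_inner \<alpha> \<sigma>\<^sub>1 \<sigma>\<^sub>1 \<and>
     (\<forall>k. trial_ok n m gbar Hbar \<theta> \<alpha> (s k)) \<and>
     (\<forall>k. if accepted m F \<alpha> (s k)
          then outer (s (Suc k)) = outer (s k) + 1 \<and>
               xprev (s (Suc k)) = xcur (s k) \<and>
               xcur (s (Suc k)) = xtrial (s k) \<and>
               sigma (s (Suc k)) = \<alpha> powi (int (inneridx (s k)) - 1) * sigma (s k) \<and>
               inneridx (s (Suc k)) = first_inner \<alpha> \<sigma>\<^sub>1 (sigma (s (Suc k)))
          else outer (s (Suc k)) = outer (s k) \<and>
               xprev (s (Suc k)) = xprev (s k) \<and>
               xcur (s (Suc k)) = xcur (s k) \<and>
               sigma (s (Suc k)) = sigma (s k) \<and>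
               inneridx (s (Suc k)) = inneridx (s k) + 1)"


section \<open>Finite-difference Hessians\<close>

datatype fd_scheme = Forward | Backward | Central

fun fd_column :: "fd_scheme \<Rightarrow> (evec \<Rightarrow> evec) \<Rightarrow> real \<Rightarrow> evec \<Rightarrow> nat \<Rightarrow> evec" where
  "fd_column Forward G h x l = (G (x + h *\<^sub>R basis_vec l) - G x) /\<^sub>R h"
| "fd_column Backward G h x l = (G x - G (x - h *\<^sub>R basis_vec l)) /\<^sub>R h"
| "fd_column Central G h x l =
     (G (x + h *\<^sub>R basis_vec l) - G (x - h *\<^sub>R basis_vec l)) /\<^sub>R (2 * h)"

definition fd_matrix :: "fd_scheme \<Rightarrow> (evec \<Rightarrow> evec) \<Rightarrow> real \<Rightarrow> evec \<Rightarrow> matrix" where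
  "fd_matrix c G h x = (\<lambda>i l. coord (fd_column c G h x l) i)"

definition symm_part :: "matrix \<Rightarrow> matrix" where
  "symm_part A = (\<lambda>i k. (A i k + A k i) / 2)"

definition fd_step :: "nat \<Rightarrow> real \<Rightarrow> real \<Rightarrow> mcrm_iter \<Rightarrow> real" where
  "fd_step n \<alpha> \<beta> s =
     2 * norm (xcur s - xprev s) / (real n powr \<beta> * \<alpha> powi (int (inneridx s) - 1))"

text \<open>
  The difference scheme may vary with the iteration and with the objective, but not with the
  column.
\<close>

definition fd_hess ::
    "nat \<Rightarrow> (nat \<Rightarrow> evec \<Rightarrow> real) \<Rightarrow> real \<Rightarrow> real \<Rightarrow>
     (mcrm_iter \<Rightarrow> nat \<Rightarrow> fd_scheme) \<Rightarrow> mcrm_iter \<Rightarrow> nat \<Rightarrow> matrix" where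
  "fd_hess n F \<alpha> \<beta> c s j =
     symm_part (fd_matrix (c s j) (grad n (F j)) (fd_step n \<alpha> \<beta> s) (xcur s))"

definition exact_grad ::
    "nat \<Rightarrow> (nat \<Rightarrow> evec \<Rightarrow> real) \<Rightarrow> mcrm_iter \<Rightarrow> nat \<Rightarrow> evec" where
  "exact_grad n F s j = grad n (F j) (xcur s)"


section \<open>Evaluation counts\<close>

text \<open>
  Evaluations needed for the \<open>j\<close>-th objective in one inner iteration, nothing being reused from
  earlier iterations: the gradient at \<open>x\<^sub>t\<close>, the gradients at the shifted points of the
  difference scheme, and, for Step 1.3, the function values at \<open>x\<^sub>t\<close> and at the trial point.
\<close>

fun shifted_grad_evals :: "nat \<Rightarrow> fd_scheme \<Rightarrow> nat" where
  "shifted_grad_evals n Forward = n"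
| "shifted_grad_evals n Backward = n"
| "shifted_grad_evals n Central = 2 * n"

definition inner_evals ::
    "nat \<Rightarrow> nat \<Rightarrow> (mcrm_iter \<Rightarrow> nat \<Rightarrow> fd_scheme) \<Rightarrow> mcrm_iter \<Rightarrow> nat" where
  "inner_evals n m c s = (\<Sum>j<m. 1 + shifted_grad_evals n (c s j) + 2)"

definition total_evals ::
    "nat \<Rightarrow> nat \<Rightarrow> (mcrm_iter \<Rightarrow> nat \<Rightarrow> fd_scheme) \<Rightarrow> (nat \<Rightarrow> mcrm_iter) \<Rightarrow> nat \<Rightarrow> nat" where
  "total_evals n m c s k = (\<Sum>k'\<le>k. inner_evals n m c (s k'))"

end

theory Submission
  imports Defs
begin

text \<open>
  The difference quotients approximate the Hessian at \<open>x\<^sub>t\<close> up to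
  \<open>\<alpha> L N \<parallel>x\<^sub>t - x\<^bsub>t-1\<^esub>\<parallel> / \<alpha>\<^sup>i\<close> with \<open>N = n\<^bsup>1/2-\<beta>\<^esup>\<close>, so a trial point is accepted as soon as
  \<open>\<alpha>\<^sup>i \<sigma>\<^sub>t \<ge> 10 \<alpha> L N\<close>, and the regularization parameters remain of order \<open>N\<close> throughout. A
  trial point that is not \<open>\<epsilon>\<close>-critical then has
  \<open>\<parallel>x\<^bsub>t+1\<^esub> - x\<^sub>t\<parallel>\<^sup>2 + \<parallel>x\<^sub>t - x\<^bsub>t-1\<^esub>\<parallel>\<^sup>2\<close> at least of order \<open>\<epsilon> / N\<close>. On the other hand, the sum of the
  cubes of the step lengths is bounded, because the potential
  \<open>F\<^sub>j(x\<^sub>t) + (1/12 + \<gamma>) \<sigma>\<^sub>t \<parallel>x\<^sub>t - x\<^bsub>t-1\<^esub>\<parallel>\<^sup>3\<close> with \<open>\<gamma> = (\<alpha> - 1) / 24\<close> drops by a multiple of these cubes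
  in every accepted step. This leaves \<open>O((N / \<epsilon>)\<^bsup>3/2\<^esup>)\<close> accepted steps. A rejection
  multiplies \<open>\<alpha>\<^sup>i \<sigma>\<^sub>t\<close> by \<open>\<alpha>\<close> and an acceptance divides it by at most \<open>\<alpha>\<close>, so the
  rejections exceed the acceptances only by a logarithmic term.
\<close>

section \<open>Vectors and matrices\<close>

lemma Rn_zero [simp]: "0 \<in> Rn n"
  and Rn_add: "x \<in> Rn n \<Longrightarrow> y \<in> Rn n \<Longrightarrow> x + y \<in> Rn n"
  and Rn_diff: "x \<in> Rn n \<Longrightarrow> y \<in> Rn n \<Longrightarrow> x - y \<in> Rn n"
  and Rn_scaleR: "x \<in> Rn n \<Longrightarrow> r *\<^sub>R x \<in> Rn n"
  by (auto simp: Rn_def)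

lemma Rn_sum: "(\<And>i. i \<in> A \<Longrightarrow> u i \<in> Rn n) \<Longrightarrow> sum u A \<in> Rn n"
  by (induction A rule: infinite_finite_induct) (auto intro: Rn_add)

lemma basis_vec_Rn: "l < n \<Longrightarrow> basis_vec l \<in> Rn n"
  by (auto simp: Rn_def)

lemma coord_sum: "coord (sum u A) i = (\<Sum>a\<in>A. coord (u a) i)"
  by (induction A rule: infinite_finite_induct) auto

lemma inner_basis_vec [simp]: "x \<bullet> basis_vec l = coord x l"
  by (subst inner_evec_eq_sum[of "{l}"]) auto

lemma norm_basis_vec [simp]: "norm (basis_vec l) = 1"
  by (simp add: norm_eq_sqrt_inner)

lemma bounded_linear_coord: "bounded_linear (\<lambda>x. coord x i)"
  using bounded_linear_inner_left[of "basis_vec i"] by simp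

lemma Rn_eq_sum:
  assumes "x \<in> Rn n"
  shows "x = (\<Sum>i<n. coord x i *\<^sub>R basis_vec i)"
proof (rule evec_eqI)
  fix i
  have "(\<Sum>a<n. coord x a * (if i = a then 1 else 0)) = (if i < n then coord x i else 0)"
    by (simp add: if_distrib cong: if_cong)
  then show "coord x i = coord (\<Sum>i<n. coord x i *\<^sub>R basis_vec i) i"
    using assms by (simp add: coord_sum Rn_def)
qed

lemma inner_Rn: "x \<in> Rn n \<Longrightarrow> x \<bullet> y = (\<Sum>i<n. coord x i * coord y i)"
  by (rule inner_evec_eq_sum) (auto simp: Rn_def not_less[symmetric])

lemma mat_vec_Rn [simp]: "mat_vec n A v \<in> Rn n"
  by (auto simp: mat_vec_def intro!: Rn_sum Rn_scaleR basis_vec_Rn)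

lemma coord_mat_vec: "i < n \<Longrightarrow> coord (mat_vec n A v) i = (\<Sum>k<n. A i k * coord v k)"
  by (simp add: mat_vec_def coord_sum if_distrib cong: if_cong)

lemma mat_vec_cong:
  "(\<And>i k. i < n \<Longrightarrow> k < n \<Longrightarrow> A i k = B i k) \<Longrightarrow> mat_vec n A v = mat_vec n B v"
  by (simp add: mat_vec_def)

lemma mat_vec_basis_vec: "l < n \<Longrightarrow> i < n \<Longrightarrow> coord (mat_vec n A (basis_vec l)) i = A i l"
  by (simp add: coord_mat_vec if_distrib cong: if_cong)

lemma bounded_linear_mat_vec: "bounded_linear (mat_vec n A)"
  unfolding mat_vec_def
  by (intro bounded_linear_sum bounded_linear_scaleR_const bounded_linear_const_mult
      bounded_linear_coord)

lemma inner_mat_vec_left: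
  "mat_vec n A v \<bullet> w = (\<Sum>i<n. \<Sum>k<n. A i k * coord v k * coord w i)"
  by (subst inner_Rn[OF mat_vec_Rn]) (simp add: coord_mat_vec sum_distrib_right)

lemma mat_vec_transpose: "mat_vec n A v \<bullet> w = v \<bullet> mat_vec n (\<lambda>i k. A k i) w"
  unfolding inner_mat_vec_left inner_commute[of v]
  by (subst sum.swap) (simp add: mult_ac)

lemma mat_vec_diff: "mat_vec n (\<lambda>i k. A i k - B i k) v = mat_vec n A v - mat_vec n B v"
  by (simp add: mat_vec_def left_diff_distrib sum_subtractf scaleR_left_diff_distrib)

lemma norm_mat_vec_diff_le: "norm (mat_vec n A v - mat_vec n B v) \<le> mat_dist n A B * norm v"
  unfolding mat_dist_def mat_vec_diff[symmetric] by (rule onorm[OF bounded_linear_mat_vec])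

lemma mat_vec_columns:
  assumes "\<And>l. l < n \<Longrightarrow> C l \<in> Rn n"
  shows "mat_vec n (\<lambda>i l. coord (C l) i) v = (\<Sum>l<n. coord v l *\<^sub>R C l)"
proof (rule evec_eqI)
  fix i
  have "(\<Sum>l<n. coord v l *\<^sub>R C l) \<in> Rn n"
    using assms by (auto intro!: Rn_sum Rn_scaleR)
  moreover have "mat_vec n (\<lambda>i l. coord (C l) i) v \<in> Rn n" by simp
  ultimately show "coord (mat_vec n (\<lambda>i l. coord (C l) i) v) i = coord (\<Sum>l<n. coord v l *\<^sub>R C l) i"
    by (cases "i < n") (auto simp: coord_mat_vec coord_sum mult.commute Rn_def)
qed

text \<open>Cauchy-Schwarz against the all-ones vector; this is the origin of the factor
  \<open>sqrt n\<close> in the Hessian error.\<close>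

lemma sum_abs_coord_le: "(\<Sum>l<n. \<bar>coord v l\<bar>) \<le> sqrt (real n) * norm v"
proof -
  \<comment> \<open>\<open>v\<close> need not lie in \<open>Rn n\<close>, so it is first replaced by
    its orthogonal projection \<open>?w\<close>, whose norm is at most that of
    \<open>v\<close>.\<close>
  let ?w = "\<Sum>l<n. coord v l *\<^sub>R basis_vec l"
  have w: "?w \<in> Rn n" "\<And>l. l < n \<Longrightarrow> coord ?w l = coord v l"
    by (auto intro!: Rn_sum Rn_scaleR basis_vec_Rn simp: coord_sum if_distrib cong: if_cong)
  have wv: "?w \<bullet> v = (\<Sum>l<n. (coord v l)\<^sup>2)" "?w \<bullet> ?w = (\<Sum>l<n. (coord v l)\<^sup>2)"
    using w by (auto simp: inner_Rn power2_eq_square)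
  then have "norm ?w * norm ?w \<le> norm ?w * norm v"
    using norm_cauchy_schwarz[of ?w v] by (simp add: power2_norm_eq_inner flip: power2_eq_square)
  then have "norm ?w \<le> norm v"
    by (cases "?w = 0") (auto simp: mult_le_cancel_left)
  moreover have "(\<Sum>l<n. \<bar>coord v l\<bar>) \<le> sqrt (real n) * norm ?w"
  proof -
    have "(\<Sum>l<n. \<bar>coord v l\<bar>) \<le> L2_set (\<lambda>_. 1) {..<n} * L2_set (coord v) {..<n}"
      using L2_set_mult_ineq[where f="\<lambda>_. 1" and g="coord v" and A="{..<n}"] by simp
    also have "\<dots> = sqrt (real n) * norm ?w"
      using wv by (simp add: L2_set_def norm_eq_sqrt_inner)
    finally show ?thesis .
  qed
  ultimately show ?thesis
    by (meson mult_left_mono order_trans real_sqrt_ge_zero of_nat_0_le_iff)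
qed

lemma norm_mat_vec_le_columns:
  assumes "\<And>l. l < n \<Longrightarrow> C l \<in> Rn n" "\<And>l. l < n \<Longrightarrow> norm (C l) \<le> b"
  shows "norm (mat_vec n (\<lambda>i l. coord (C l) i) v) \<le> sqrt (real n) * b * norm v"
proof (cases "n = 0")
  case False
  then have b: "0 \<le> b" using assms(2)[of 0] norm_ge_zero[of "C 0"] by linarith
  have "norm (mat_vec n (\<lambda>i l. coord (C l) i) v) \<le> (\<Sum>l<n. norm (coord v l *\<^sub>R C l))"
    using norm_sum[of "\<lambda>l. coord v l *\<^sub>R C l" "{..<n}"] by (simp add: mat_vec_columns assms)
  also have "\<dots> \<le> (\<Sum>l<n. \<bar>coord v l\<bar> * b)"
    by (intro sum_mono) (auto intro!: mult_left_mono assms)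
  also have "\<dots> \<le> sqrt (real n) * norm v * b"
    unfolding sum_distrib_right[symmetric] using sum_abs_coord_le b by (rule mult_right_mono)
  finally show ?thesis by (simp add: mult_ac)
qed (simp add: mat_vec_def)

text \<open>With w the transpose applied to v, |w|^2 = <A w, v> \<le> b |w| |v|; divide by
  |w|.\<close>

lemma norm_mat_vec_transpose_le:
  assumes "\<And>v. norm (mat_vec n A v) \<le> b * norm v"
  shows "norm (mat_vec n (\<lambda>i k. A k i) v) \<le> b * norm v"
proof -
  let ?w = "mat_vec n (\<lambda>i k. A k i) v"
  have "norm ?w ^ 2 = mat_vec n A ?w \<bullet> v"
    by (metis mat_vec_transpose power2_norm_eq_inner)
  also have "\<dots> \<le> (b * norm ?w) * norm v"
    by (meson assms mult_right_mono norm_cauchy_schwarz norm_ge_zero order_trans)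
  finally have le: "norm ?w * norm ?w \<le> norm ?w * (b * norm v)"
    by (simp add: power2_eq_square mult_ac)
  have "0 \<le> b * norm v" using assms[of v] norm_ge_zero order_trans by blast
  with le show ?thesis by (cases "?w = 0") (auto simp: mult_le_cancel_left)
qed

text \<open>Because \<open>H\<close> is symmetric, the error of the symmetric part is the mean of
  the error matrix and its transpose. Both obey the same bound, so symmetrization costs nothing in
  the constant.\<close>

lemma norm_symm_part_diff_le:
  assumes sym: "\<And>i k. i < n \<Longrightarrow> k < n \<Longrightarrow> H i k = H k i"
    and b: "\<And>v. norm (mat_vec n (\<lambda>i k. A i k - H i k) v) \<le> b * norm v"
  shows "norm (mat_vec n (symm_part A) v - mat_vec n H v) \<le> b * norm v"
proof -
  let ?E = "\<lambda>i k. A i k - H i k"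
  have "mat_vec n (symm_part A) v - mat_vec n H v =
      (1/2) *\<^sub>R (mat_vec n ?E v + mat_vec n (\<lambda>i k. ?E k i) v)"
  proof (rule evec_eqI)
    fix i
    have *: "coord (mat_vec n X v) i = 0" if "\<not> i < n" for X
      using mat_vec_Rn[of n X v] that by (auto simp: Rn_def)
    have "(\<Sum>k<n. (A i k + A k i) / 2 * coord v k) - (\<Sum>k<n. H i k * coord v k) =
      (1/2) * ((\<Sum>k<n. (A i k - H i k) * coord v k) + (\<Sum>k<n. (A k i - H k i) * coord v k))"
      if "i < n"
      unfolding sum.distrib[symmetric] sum_distrib_left sum_subtractf[symmetric]
      by (intro sum.cong) (auto simp: sym that field_simps)
    then show "coord (mat_vec n (symm_part A) v - mat_vec n H v) i =
      coord ((1/2) *\<^sub>R (mat_vec n ?E v + mat_vec n (\<lambda>i k. ?E k i) v)) i"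
      by (cases "i < n") (simp_all add: coord_mat_vec * symm_part_def)
  qed
  also have "norm \<dots> \<le> 1/2 * (b * norm v + b * norm v)"
    unfolding norm_scaleR
    using b[of v] norm_mat_vec_transpose_le[of n ?E b v, OF b]
    by (intro mult_mono norm_triangle_mono) auto
  finally show ?thesis by simp
qed

lemma symmetric_mat_vec_inner:
  assumes "\<And>i k. i < n \<Longrightarrow> k < n \<Longrightarrow> H i k = H k i"
  shows "mat_vec n H v \<bullet> w = mat_vec n H w \<bullet> v"
proof -
  have "mat_vec n (\<lambda>i k. H k i) w = mat_vec n H w"
    by (simp add: mat_vec_def assms)
  then show ?thesis
    by (metis mat_vec_transpose inner_commute)
qed

section \<open>Taylor estimates\<close>

text \<open>A derivative within \<open>Rn n\<close> is tested only on increments from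
  \<open>Rn n\<close>, where \<open>D\<close> agrees with the inner product against the vector of
  its values on the basis. This gives the existence half of the definite description in
  \<open>grad\<close>.\<close>

lemma has_derivative_grad:
  assumes "f differentiable_on Rn n" "x \<in> Rn n"
  shows "grad n f x \<in> Rn n" "(f has_derivative (\<lambda>v. grad n f x \<bullet> v)) (at x within Rn n)"
proof -
  obtain D where D: "(f has_derivative D) (at x within Rn n)"
    using assms by (auto simp: differentiable_on_def differentiable_def)
  define g where "g = (\<Sum>i<n. D (basis_vec i) *\<^sub>R basis_vec i)"
  have g: "g \<in> Rn n"
    unfolding g_def by (auto intro!: Rn_sum Rn_scaleR basis_vec_Rn)
  interpret bounded_linear D using D by (rule has_derivative_bounded_linear)
  have *: "D v = g \<bullet> v" if "v \<in> Rn n" for v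
  proof -
    have "D v = (\<Sum>i<n. coord v i * D (basis_vec i))"
      by (subst Rn_eq_sum[OF that]) (simp add: sum scaleR)
    also have "\<dots> = g \<bullet> v"
      by (simp add: g_def inner_sum_left inner_commute[of "basis_vec _"] mult.commute)
    finally show ?thesis .
  qed
  have "(f has_derivative (\<lambda>v. g \<bullet> v)) (at x within Rn n)"
    unfolding has_derivative_within
  proof (intro conjI bounded_linear_inner_right)
    have "((\<lambda>y. (1 / norm (y - x)) *\<^sub>R (f y - (f x + D (y - x)))) \<longlongrightarrow> 0) (at x within Rn n)"
      using D by (simp add: has_derivative_within)
    then show "((\<lambda>y. (1 / norm (y - x)) *\<^sub>R (f y - (f x + g \<bullet> (y - x)))) \<longlongrightarrow> 0) (at x within Rn n)"
      by (rule Lim_transform_eventually)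
        (auto simp: eventually_at_filter * Rn_diff assms(2) intro!: always_eventually)
  qed
  with grad_eqI[OF assms(2) g this] g
  show "grad n f x \<in> Rn n" "(f has_derivative (\<lambda>v. grad n f x \<bullet> v)) (at x within Rn n)"
    by auto
qed

text \<open>The whole line stays in \<open>Rn n\<close>, so a derivative within the subspace becomes
  an ordinary derivative in \<open>t\<close>.\<close>

lemma has_field_derivative_along:
  assumes "f differentiable_on Rn n" "x \<in> Rn n" "v \<in> Rn n"
  shows "((\<lambda>t. f (x + t *\<^sub>R v)) has_real_derivative grad n f (x + t *\<^sub>R v) \<bullet> v) (at t)"
proof -
  have path: "((\<lambda>t :: real. x + t *\<^sub>R v) has_derivative (\<lambda>t. t *\<^sub>R v)) (at t)"
    by (auto intro!: derivative_eq_intros)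
  have "(f has_derivative (\<lambda>u. grad n f (x + t *\<^sub>R v) \<bullet> u))
      (at (x + t *\<^sub>R v) within range (\<lambda>t. x + t *\<^sub>R v))"
    using assms by (intro has_derivative_subset[OF has_derivative_grad(2)])
      (auto intro!: Rn_add Rn_scaleR)
  from has_derivative_in_compose[OF path this] show ?thesis
    by (simp add: has_field_derivative_def mult_commute_abs)
qed

text \<open>Assumption (A1) for a single objective; every objective is later given the common
  constant, the maximum of the individual ones.\<close>

locale lipschitz_hessian =
  fixes n :: nat and f :: "evec \<Rightarrow> real" and L :: real
  assumes C2: "C2_on_Rn n f"
    and lip: "\<And>y z. y \<in> Rn n \<Longrightarrow> z \<in> Rn n \<Longrightarrow>
      mat_dist n (hess n f y) (hess n f z) \<le> L * norm (y - z)"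
begin

lemma grad_Rn: "x \<in> Rn n \<Longrightarrow> grad n f x \<in> Rn n"
  using C2 has_derivative_grad by (auto simp: C2_on_Rn_def)

lemma grad_has_vector_derivative_along:
  assumes x: "x \<in> Rn n" and v: "v \<in> Rn n"
  shows "((\<lambda>t. grad n f (x + t *\<^sub>R v)) has_vector_derivative
      mat_vec n (hess n f (x + t *\<^sub>R v)) v) (at t)"
proof -
  let ?g = "\<lambda>i y. coord (grad n f y) i"
  have "((\<lambda>t. ?g i (x + t *\<^sub>R v)) has_real_derivative
      (\<Sum>k<n. hess n f (x + t *\<^sub>R v) i k * coord v k)) (at t)" if "i < n" for i
  proof -
    have d: "?g i differentiable_on Rn n" using C2 that by (simp add: C2_on_Rn_def)
    have xt: "x + t *\<^sub>R v \<in> Rn n" using x v by (auto intro: Rn_add Rn_scaleR)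
    have "grad n (?g i) (x + t *\<^sub>R v) \<bullet> v = (\<Sum>k<n. hess n f (x + t *\<^sub>R v) i k * coord v k)"
      by (simp add: inner_Rn[OF has_derivative_grad(1)[OF d xt]] hess_def)
    then show ?thesis using has_field_derivative_along[OF d x v, of t] by simp
  qed
  then have "((\<lambda>t. \<Sum>i<n. ?g i (x + t *\<^sub>R v) *\<^sub>R basis_vec i) has_vector_derivative
      (\<Sum>i<n. (\<Sum>k<n. hess n f (x + t *\<^sub>R v) i k * coord v k) *\<^sub>R basis_vec i)) (at t)"
    by (intro has_vector_derivative_sum)
      (auto intro!: derivative_eq_intros simp: has_real_derivative_iff_has_vector_derivative)
  moreover have "(\<lambda>t. \<Sum>i<n. ?g i (x + t *\<^sub>R v) *\<^sub>R basis_vec i) = (\<lambda>t. grad n f (x + t *\<^sub>R v))"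
    using x v by (auto intro!: Rn_eq_sum[symmetric] grad_Rn Rn_add Rn_scaleR)
  ultimately show ?thesis by (simp add: mat_vec_def)
qed

lemma norm_hess_diff_le:
  assumes "y \<in> Rn n" "z \<in> Rn n"
  shows "norm (mat_vec n (hess n f y) v - mat_vec n (hess n f z) v) \<le> L * norm (y - z) * norm v"
  by (meson assms lip mult_right_mono norm_ge_zero norm_mat_vec_diff_le order_trans)

text \<open>Along the segment the remainder moves at speed at most L |v|^2 t; the mean value
  inequality compares it with the real function that grows at exactly this speed.\<close>

lemma grad_taylor:
  assumes x: "x \<in> Rn n" and v: "v \<in> Rn n"
  shows "norm (grad n f (x + v) - grad n f x - mat_vec n (hess n f x) v) \<le> L / 2 * norm v ^ 2"
proof -
  let ?H = "\<lambda>t. mat_vec n (hess n f (x + t *\<^sub>R v)) v"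
  let ?\<psi> = "\<lambda>t. grad n f (x + t *\<^sub>R v) - t *\<^sub>R mat_vec n (hess n f x) v"
  let ?\<phi> = "\<lambda>t::real. L / 2 * norm v ^ 2 * t ^ 2"
  have d: "(?\<psi> has_vector_derivative ?H t - mat_vec n (hess n f x) v) (at t)" for t
    by (auto intro!: derivative_eq_intros grad_has_vector_derivative_along x v)
  have d': "(?\<phi> has_vector_derivative L * norm v ^ 2 * t) (at t)" for t
    by (auto intro!: derivative_eq_intros
        simp flip: has_real_derivative_iff_has_vector_derivative)
  have "norm (?\<psi> 1 - ?\<psi> 0) \<le> ?\<phi> 1 - ?\<phi> 0"
  proof (rule differentiable_bound_general[OF _ _ _ d d'])
    show "continuous_on {0..1} ?\<psi>"
      by (intro continuous_at_imp_continuous_on ballI has_vector_derivative_continuous[OF d])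
    show "continuous_on {0..1} ?\<phi>" by (intro continuous_intros)
    fix t :: real assume t: "0 < t" "t < 1"
    have "x + t *\<^sub>R v \<in> Rn n" using x v by (auto intro: Rn_add Rn_scaleR)
    from norm_hess_diff_le[OF this x, of v] t
    show "norm (?H t - mat_vec n (hess n f x) v) \<le> L * norm v ^ 2 * t"
      by (simp add: power2_eq_square mult_ac)
  qed simp
  then show ?thesis by (simp add: algebra_simps)
qed

text \<open>The same comparison one order higher: the t-derivative of the remainder is the remainder
  of \<open>grad_taylor\<close> at t v, paired with v.\<close>

lemma taylor:
  assumes x: "x \<in> Rn n" and v: "v \<in> Rn n"
  shows "\<bar>f (x + v) - f x - grad n f x \<bullet> v - mat_vec n (hess n f x) v \<bullet> v / 2\<bar> \<le> L / 6 * norm v ^ 3"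
proof -
  let ?q = "mat_vec n (hess n f x) v \<bullet> v"
  let ?\<psi> = "\<lambda>t. f (x + t *\<^sub>R v) - t * (grad n f x \<bullet> v) - t ^ 2 * ?q / 2"
  let ?\<phi> = "\<lambda>t::real. L / 6 * norm v ^ 3 * t ^ 3"
  let ?\<psi>' = "\<lambda>t. grad n f (x + t *\<^sub>R v) \<bullet> v - grad n f x \<bullet> v - t * ?q"
  have "f differentiable_on Rn n" using C2 by (simp add: C2_on_Rn_def)
  then have d: "(?\<psi> has_vector_derivative ?\<psi>' t) (at t)" for t
    unfolding has_real_derivative_iff_has_vector_derivative[symmetric]
    by (auto intro!: derivative_eq_intros has_field_derivative_along x v)
  have d': "(?\<phi> has_vector_derivative L / 2 * norm v ^ 3 * t ^ 2) (at t)" for t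
    by (auto intro!: derivative_eq_intros
        simp flip: has_real_derivative_iff_has_vector_derivative)
  have "norm (?\<psi> 1 - ?\<psi> 0) \<le> ?\<phi> 1 - ?\<phi> 0"
  proof (rule differentiable_bound_general[OF _ _ _ d d'])
    show "continuous_on {0..1} ?\<psi>"
      by (intro continuous_at_imp_continuous_on ballI has_vector_derivative_continuous[OF d])
    show "continuous_on {0..1} ?\<phi>" by (intro continuous_intros)
    fix t :: real assume t: "0 < t" "t < 1"
    let ?r = "grad n f (x + t *\<^sub>R v) - grad n f x - mat_vec n (hess n f x) (t *\<^sub>R v)"
    have "?\<psi>' t = ?r \<bullet> v"
      by (simp add: inner_diff_left linear_scale[OF bounded_linear.linear[OF bounded_linear_mat_vec]])
    also have "norm \<dots> \<le> norm ?r * norm v" by (simp add: Cauchy_Schwarz_ineq2)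
    also have "\<dots> \<le> L / 2 * norm (t *\<^sub>R v) ^ 2 * norm v"
      using v by (intro mult_right_mono grad_taylor x Rn_scaleR) auto
    finally show "norm (?\<psi>' t) \<le> L / 2 * norm v ^ 3 * t ^ 2"
      using t by (simp add: power2_eq_square power3_eq_cube mult_ac)
  qed simp
  then show ?thesis by (simp add: algebra_simps)
qed

text \<open>
  The second-order part of the expansion of \<^term>\<open>f\<close> at \<^term>\<open>x\<close> sees only the symmetric part of
  the Hessian, whereas expanding through \<^term>\<open>x + v\<close> produces the full bilinear form in
  \<open>(v, w)\<close>. Their difference is of third order in the scaling of \<open>v\<close> and \<open>w\<close>.
\<close>

lemma hess_form_commute:
  assumes x: "x \<in> Rn n" and v: "v \<in> Rn n" and w: "w \<in> Rn n"
  shows "mat_vec n (hess n f x) v \<bullet> w = mat_vec n (hess n f x) w \<bullet> v"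
proof -
  let ?H = "mat_vec n (hess n f x)"
  interpret H: bounded_linear ?H by (rule bounded_linear_mat_vec)
  define \<delta> where "\<delta> = \<bar>?H v \<bullet> w - ?H w \<bullet> v\<bar>"
  \<comment> \<open>The five remainder terms of the estimate below, taken at scale r = 1; each is
    homogeneous of degree three.\<close>
  define K where "K = L / 6 * (norm (v + w) ^ 3 + norm v ^ 3 + norm w ^ 3)
      + L / 2 * (norm v ^ 2 * norm w + norm v * norm w ^ 2)"
  have bound: "\<delta> \<le> 2 * K * r" if r: "r > 0" for r
  proof -
    let ?V = "r *\<^sub>R v" and ?W = "r *\<^sub>R w"
    let ?H' = "mat_vec n (hess n f (x + ?V))"
    have in_Rn: "?V \<in> Rn n" "?W \<in> Rn n" "?V + ?W \<in> Rn n" "x + ?V \<in> Rn n"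
      using x v w by (auto intro: Rn_add Rn_scaleR)
    \<comment> \<open>The value at x + V + W is expanded directly from x (1) and by way of x + V (2
      and 3); 4 and 5 move the gradient and the Hessian from x + V back to x.\<close>
    have 1: "\<bar>f (x + (?V + ?W)) - f x - grad n f x \<bullet> (?V + ?W) - ?H (?V + ?W) \<bullet> (?V + ?W) / 2\<bar>
        \<le> L / 6 * norm (?V + ?W) ^ 3"
      by (rule taylor[OF x in_Rn(3)])
    have 2: "\<bar>f (x + ?V + ?W) - f (x + ?V) - grad n f (x + ?V) \<bullet> ?W - ?H' ?W \<bullet> ?W / 2\<bar>
        \<le> L / 6 * norm ?W ^ 3"
      by (rule taylor[OF in_Rn(4,2)])
    have 3: "\<bar>f (x + ?V) - f x - grad n f x \<bullet> ?V - ?H ?V \<bullet> ?V / 2\<bar> \<le> L / 6 * norm ?V ^ 3"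
      by (rule taylor[OF x in_Rn(1)])
    have 4: "\<bar>(grad n f (x + ?V) - grad n f x - ?H ?V) \<bullet> ?W\<bar> \<le> L / 2 * norm ?V ^ 2 * norm ?W"
      by (meson Cauchy_Schwarz_ineq2 grad_taylor[OF x in_Rn(1)] mult_right_mono norm_ge_zero
          order_trans)
    have 5: "\<bar>(?H' ?W - ?H ?W) \<bullet> ?W\<bar> \<le> L * norm ?V * norm ?W * norm ?W"
    proof -
      have "norm (?H' ?W - ?H ?W) \<le> L * norm ?V * norm ?W"
        using norm_hess_diff_le[OF in_Rn(4) x, of ?W] unfolding add_diff_cancel_left' .
      then show ?thesis
        by (meson Cauchy_Schwarz_ineq2 mult_right_mono norm_ge_zero order_trans)
    qed
    have *: "?H (?V + ?W) \<bullet> (?V + ?W) = ?H ?V \<bullet> ?V + ?H ?V \<bullet> ?W + ?H ?W \<bullet> ?V + ?H ?W \<bullet> ?W"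
      by (simp add: H.add inner_add_left inner_add_right del: inner_scaleR_left inner_scaleR_right)
    have "\<bar>?H ?V \<bullet> ?W - ?H ?W \<bullet> ?V\<bar> / 2 \<le> L / 6 * norm (?V + ?W) ^ 3 + L / 6 * norm ?W ^ 3
        + L / 6 * norm ?V ^ 3 + L / 2 * norm ?V ^ 2 * norm ?W + L * norm ?V * norm ?W * norm ?W / 2"
    proof -
      \<comment> \<open>In this combination of the five estimates the function values, the gradients
        and the pure second-order terms cancel, leaving half of the asymmetry p - q of the
        form.\<close>
      have arith: "\<bar>p - q\<bar> / 2 \<le> e1 + e2 + e3 + e4 + e5 / 2"
        if "\<bar>a - f0 - (gv + gw) - s / 2\<bar> \<le> e1" "\<bar>a - b - g' - h' / 2\<bar> \<le> e2"
          "\<bar>b - f0 - gv - hv / 2\<bar> \<le> e3" "\<bar>g' - gw - p\<bar> \<le> e4" "\<bar>h' - hw\<bar> \<le> e5"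
          "s = hv + p + q + hw"
        for a b f0 gv gw s g' h' hv hw p q e1 e2 e3 e4 e5 :: real
      proof -
        have "\<bar>(q - p) / 2\<bar> = \<bar>- (a - f0 - (gv + gw) - s / 2) + (a - b - g' - h' / 2)
            + (b - f0 - gv - hv / 2) + (g' - gw - p) + (h' - hw) / 2\<bar>"
          by (rule arg_cong[of _ _ abs]) (simp add: that(6) field_simps)
        also have "\<dots> \<le> e1 + e2 + e3 + e4 + e5 / 2"
          using that(1-5) by (intro order_trans[OF abs_triangle_ineq] add_mono) auto
        finally show ?thesis by (simp add: abs_minus_commute)
      qed
      show ?thesis
        by (rule arith[OF 1[unfolded inner_add_right[of "grad n f x"] add.assoc[symmetric]] 2 3
          4[unfolded inner_diff_left] 5[unfolded inner_diff_left] *])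
    qed
    also have "\<dots> = r ^ 3 * K"
    proof -
      have "norm (?V + ?W) = r * norm (v + w)"
        using r by (simp flip: scaleR_add_right)
      then show ?thesis
        using r unfolding K_def
        by (simp add: power_mult_distrib) (simp add: power2_eq_square power3_eq_cube algebra_simps add_divide_distrib)
    qed
    also have "?H ?V \<bullet> ?W - ?H ?W \<bullet> ?V = r ^ 2 * (?H v \<bullet> w - ?H w \<bullet> v)"
      by (simp add: H.scaleR power2_eq_square right_diff_distrib)
    finally have "r ^ 2 * \<delta> / 2 \<le> r ^ 2 * (K * r)"
      by (simp add: \<delta>_def abs_mult power2_eq_square power3_eq_cube mult_ac)
    then have "r ^ 2 * \<delta> \<le> r ^ 2 * (2 * K * r)" by simp
    then show ?thesis using r by (simp add: mult_le_cancel_left)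
  qed
  \<comment> \<open>The left side of \<open>bound\<close> does not depend on r. The choice r = 1
    shows K > 0, and r = \<delta> / (4 K) then gives \<delta> \<le> \<delta> / 2.\<close>
  have "\<delta> = 0"
  proof (rule ccontr)
    assume "\<delta> \<noteq> 0"
    then have "\<delta> > 0" by (simp add: \<delta>_def)
    with bound[of 1] have "K > 0" by simp
    with \<open>\<delta> > 0\<close> bound[of "\<delta> / (4 * K)"] show False by simp
  qed
  then show ?thesis by (simp add: \<delta>_def)
qed

text \<open>Schwarz's theorem, read off on basis vectors; it makes the symmetrized difference matrix
  comparable with the Hessian.\<close>

lemma hess_symmetric:
  assumes "x \<in> Rn n" "i < n" "k < n"
  shows "hess n f x i k = hess n f x k i"
  using hess_form_commute[OF assms(1) basis_vec_Rn[OF assms(2)] basis_vec_Rn[OF assms(3)]] assms(2,3)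
  by (simp add: mat_vec_basis_vec)

section \<open>Finite differences\<close>

lemma norm_difference_quotient_le:
  assumes x: "x \<in> Rn n" and l: "l < n" and h: "h \<noteq> 0"
  shows "norm ((grad n f (x + h *\<^sub>R basis_vec l) - grad n f x) /\<^sub>R h
      - mat_vec n (hess n f x) (basis_vec l)) \<le> L * \<bar>h\<bar> / 2"
proof -
  let ?H = "mat_vec n (hess n f x)"
  interpret H: bounded_linear ?H by (rule bounded_linear_mat_vec)
  let ?r = "grad n f (x + h *\<^sub>R basis_vec l) - grad n f x - ?H (h *\<^sub>R basis_vec l)"
  have "(grad n f (x + h *\<^sub>R basis_vec l) - grad n f x) /\<^sub>R h - ?H (basis_vec l) = ?r /\<^sub>R h"
    using h by (simp add: H.scaleR scaleR_diff_right)
  then have "norm ((grad n f (x + h *\<^sub>R basis_vec l) - grad n f x) /\<^sub>R h - ?H (basis_vec l))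
      = norm ?r / \<bar>h\<bar>"
    by (simp only: norm_scaleR abs_inverse divide_inverse mult.commute)
  also have "\<dots> \<le> L / 2 * norm (h *\<^sub>R basis_vec l) ^ 2 / \<bar>h\<bar>"
    using l by (intro divide_right_mono grad_taylor x Rn_scaleR basis_vec_Rn) auto
  also have "\<dots> = L * \<bar>h\<bar> / 2"
  proof -
    have "norm (h *\<^sub>R basis_vec l) ^ 2 / \<bar>h\<bar> = \<bar>h\<bar>"
      using h by (cases "h > 0") (auto simp: power2_eq_square)
    then show ?thesis
      unfolding times_divide_eq_right[symmetric] by simp
  qed
  finally show ?thesis .
qed

lemma fd_column_error:
  assumes x: "x \<in> Rn n" and l: "l < n" and h: "h > 0"
  shows "norm (fd_column c (grad n f) h x l - mat_vec n (hess n f x) (basis_vec l)) \<le> L * h / 2"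
proof -
  let ?He = "mat_vec n (hess n f x) (basis_vec l)"
  let ?D = "\<lambda>h. (grad n f (x + h *\<^sub>R basis_vec l) - grad n f x) /\<^sub>R h"
  have fwd: "norm (?D h - ?He) \<le> L * h / 2"
    using norm_difference_quotient_le[OF x l, of h] h by simp
  have bwd: "norm (?D (- h) - ?He) \<le> L * h / 2"
    using norm_difference_quotient_le[OF x l, of "- h"] h by simp
  show ?thesis
  proof (cases c)
    case Forward
    then show ?thesis using fwd by simp
  next
    case Backward
    have "fd_column c (grad n f) h x l = ?D (- h)"
      by (rule evec_eqI) (simp add: Backward right_diff_distrib)
    then show ?thesis using bwd by simp
  next
    case Central
    \<comment> \<open>The central quotient is the mean of the forward and the backward one and
      inherits their common error bound.\<close>
    have "fd_column c (grad n f) h x l - ?He = (1/2) *\<^sub>R ((?D h - ?He) + (?D (- h) - ?He))"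
    proof (rule evec_eqI)
      fix i
      have "(a - b) / (2 * h) - d = (1/2) * (((a - u) / h - d) + ((b - u) / (- h) - d))"
        for a b u d :: real
      proof -
        have "(a - b) / (2 * h) = (a / h - b / h) / 2" by (simp add: diff_divide_distrib)
        then show ?thesis by (simp add: diff_divide_distrib)
      qed
      moreover have "x + (- h) *\<^sub>R basis_vec l = x - h *\<^sub>R basis_vec l" by simp
      ultimately show "coord (fd_column c (grad n f) h x l - ?He) i
          = coord ((1/2) *\<^sub>R ((?D h - ?He) + (?D (- h) - ?He))) i"
        by (simp only: Central fd_column.simps coord_diff coord_add coord_scaleR
            divide_inverse_commute)
    qed
    also have "norm \<dots> \<le> 1/2 * (L * h / 2 + L * h / 2)"
      unfolding norm_scaleR using fwd bwd by (intro mult_mono norm_triangle_mono) auto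
    finally show ?thesis by simp
  qed
qed

lemma fd_column_Rn:
  assumes "x \<in> Rn n" "l < n"
  shows "fd_column c (grad n f) h x l \<in> Rn n"
  using assms by (cases c) (auto intro!: Rn_scaleR Rn_diff Rn_add grad_Rn basis_vec_Rn)

lemma symm_part_fd_matrix_error:
  assumes x: "x \<in> Rn n" and h: "h > 0"
  shows "norm (mat_vec n (symm_part (fd_matrix c (grad n f) h x)) v - mat_vec n (hess n f x) v)
    \<le> sqrt (real n) * (L * h / 2) * norm v"
proof (rule norm_symm_part_diff_le)
  fix v
  let ?C = "\<lambda>l. fd_column c (grad n f) h x l - mat_vec n (hess n f x) (basis_vec l)"
  have "norm (mat_vec n (\<lambda>i l. coord (?C l) i) v) \<le> sqrt (real n) * (L * h / 2) * norm v"
    by (intro norm_mat_vec_le_columns Rn_diff fd_column_Rn mat_vec_Rn fd_column_error assms)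
  also have "mat_vec n (\<lambda>i l. coord (?C l) i) v
      = mat_vec n (\<lambda>i k. fd_matrix c (grad n f) h x i k - hess n f x i k) v"
    by (rule mat_vec_cong) (simp add: fd_matrix_def mat_vec_basis_vec)
  finally show "norm (mat_vec n (\<lambda>i k. fd_matrix c (grad n f) h x i k - hess n f x i k) v)
    \<le> sqrt (real n) * (L * h / 2) * norm v" .
qed (rule hess_symmetric[OF x])

end

section \<open>The cubic model\<close>

lemma has_derivative_norm_cubed:
  fixes v :: "'a :: real_inner"
  shows "((\<lambda>v. norm v ^ 3) has_derivative (\<lambda>u. 3 * norm v * (v \<bullet> u))) (at v within S)"
proof (cases "v = 0")
  \<comment> \<open>The norm is not differentiable at the origin, but there the difference quotient
    of its cube is |y|^2, which tends to 0.\<close>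
  case True
  have "((\<lambda>y. norm y ^ 2) \<longlongrightarrow> norm (0::'a) ^ 2) (at 0 within S)"
    by (intro tendsto_intros)
  moreover have "\<forall>\<^sub>F y :: 'a in at 0 within S.
      norm y ^ 2 = (1 / norm (y - 0)) *\<^sub>R (norm y ^ 3 - (norm (0::'a) ^ 3 + 0))"
    by (auto simp: eventually_at_filter power2_eq_square power3_eq_cube intro!: always_eventually)
  ultimately have "((\<lambda>y :: 'a. (1 / norm (y - 0)) *\<^sub>R (norm y ^ 3 - (norm (0::'a) ^ 3 + 0)))
      \<longlongrightarrow> norm (0::'a) ^ 2) (at 0 within S)"
    by (rule Lim_transform_eventually)
  then show ?thesis unfolding True has_derivative_within by simp
next
  case False
  show ?thesis
    using has_derivative_power[OF has_derivative_at_withinI[OF has_derivative_norm[OF False]], of 3 S]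
    by (rule has_derivative_eq_rhs)
      (use False in \<open>simp add: fun_eq_iff sgn_div_norm power2_eq_square inner_commute\<close>)
qed

lemma grad_cubic_model:
  assumes in_Rn: "g \<in> Rn n" "x \<in> Rn n" "v \<in> Rn n"
    and sym: "\<And>i k. i < n \<Longrightarrow> k < n \<Longrightarrow> B i k = B k i"
  shows "grad n (cubic_model n g B x \<sigma>) (x + v) = g + mat_vec n B v + (\<sigma> / 2 * norm v) *\<^sub>R v"
proof (rule grad_eqI)
  show "g + mat_vec n B v + (\<sigma> / 2 * norm v) *\<^sub>R v \<in> Rn n"
    using in_Rn by (auto intro!: Rn_add Rn_scaleR)
  interpret B: bounded_linear "mat_vec n B" by (rule bounded_linear_mat_vec)
  have shift: "((\<lambda>y. y - x) has_derivative (\<lambda>u. u)) (at (x + v) within Rn n)"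
    by (auto intro!: derivative_eq_intros)
  have B: "((\<lambda>y. mat_vec n B (y - x)) has_derivative mat_vec n B) (at (x + v) within Rn n)"
    using B.has_derivative[OF shift] .
  have cube: "((\<lambda>y. norm (y - x) ^ 3) has_derivative (\<lambda>u. 3 * norm v * (v \<bullet> u)))
      (at (x + v) within Rn n)"
    using has_derivative_in_compose[OF shift has_derivative_norm_cubed] by simp
  \<comment> \<open>Symmetry of \<open>B\<close> makes the two halves of the derivative of the
    quadratic form coincide.\<close>
  have Bv: "mat_vec n B u \<bullet> v = mat_vec n B v \<bullet> u" for u
    by (rule symmetric_mat_vec_inner) (rule sym)
  have "((\<lambda>y. cubic_model n g B x \<sigma> y) has_derivative
      (\<lambda>u. g \<bullet> u + 1/2 * (mat_vec n B v \<bullet> u + mat_vec n B u \<bullet> v) + \<sigma> / 6 * (3 * norm v * (v \<bullet> u))))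
      (at (x + v) within Rn n)"
    unfolding cubic_model_def
    by (rule has_derivative_eq_rhs, rule has_derivative_add[OF has_derivative_add[OF
      has_derivative_inner_right[OF shift] has_derivative_mult_right[OF has_derivative_inner[OF B shift]]]
      has_derivative_mult_right[OF cube]]) simp
  then show "(cubic_model n g B x \<sigma> has_derivative
      (\<lambda>u. (g + mat_vec n B v + (\<sigma> / 2 * norm v) *\<^sub>R v) \<bullet> u)) (at (x + v) within Rn n)"
    by (simp add: Bv inner_add_left mult.assoc)
qed (use in_Rn in \<open>auto intro: Rn_add\<close>)

context lipschitz_hessian
begin

text \<open>Needs two distinct points of \<open>Rn n\<close>: the origin and the first basis vector,
  at distance 1.\<close>

lemma lipschitz_const_nonneg:
  assumes "n \<ge> 1"
  shows "0 \<le> L"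
proof -
  have "0 \<le> mat_dist n (hess n f (basis_vec 0)) (hess n f 0)"
    unfolding mat_dist_def by (rule onorm_pos_le[OF bounded_linear_mat_vec])
  also have "\<dots> \<le> L * norm (basis_vec 0 - 0)"
    using assms by (intro lip basis_vec_Rn) auto
  finally show ?thesis by simp
qed

text \<open>Prepares the acceptance test: the Hessian error enters quadratically, while a large
  \<sigma> makes the cubic correction negative.\<close>

lemma le_cubic_model:
  assumes x: "x \<in> Rn n" and v: "v \<in> Rn n"
    and err: "\<And>v. norm (mat_vec n B v - mat_vec n (hess n f x) v) \<le> e * norm v"
  shows "f (x + v) - f x \<le> cubic_model n (grad n f x) B x \<sigma> (x + v)
      + e / 2 * norm v ^ 2 + (L - \<sigma>) / 6 * norm v ^ 3"
proof -
  have "\<bar>(mat_vec n B v - mat_vec n (hess n f x) v) \<bullet> v\<bar> \<le> e * norm v * norm v"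
    by (meson Cauchy_Schwarz_ineq2 err mult_right_mono norm_ge_zero order_trans)
  then have "mat_vec n (hess n f x) v \<bullet> v \<le> mat_vec n B v \<bullet> v + e * norm v ^ 2"
    by (simp add: inner_diff_left power2_eq_square abs_le_iff)
  moreover have "f (x + v) - f x - grad n f x \<bullet> v - mat_vec n (hess n f x) v \<bullet> v / 2
      \<le> L / 6 * norm v ^ 3"
    using taylor[OF x v] by (simp only: abs_le_iff)
  moreover have "(L - \<sigma>) / 6 * norm v ^ 3 = L / 6 * norm v ^ 3 - \<sigma> / 6 * norm v ^ 3"
    by (simp add: diff_divide_distrib left_diff_distrib)
  ultimately show ?thesis
    unfolding cubic_model_def add_diff_cancel_left' by linarith
qed

text \<open>Transfers stationarity from the model to the objective; the error consists of the Taylor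
  remainder, the Hessian error and the gradient of the cubic term.\<close>

lemma norm_grad_diff_cubic_model_le:
  assumes x: "x \<in> Rn n" and v: "v \<in> Rn n" and \<sigma>: "\<sigma> \<ge> 0"
    and sym: "\<And>i k. i < n \<Longrightarrow> k < n \<Longrightarrow> B i k = B k i"
    and err: "\<And>v. norm (mat_vec n B v - mat_vec n (hess n f x) v) \<le> e * norm v"
  shows "norm (grad n f (x + v) - grad n (cubic_model n (grad n f x) B x \<sigma>) (x + v))
    \<le> (L + \<sigma>) / 2 * norm v ^ 2 + e * norm v"
proof -
  let ?H = "mat_vec n (hess n f x) v" and ?B = "mat_vec n B v"
  have "grad n f (x + v) - grad n (cubic_model n (grad n f x) B x \<sigma>) (x + v)
      = (grad n f (x + v) - grad n f x - ?H) - (?B - ?H) - (\<sigma> / 2 * norm v) *\<^sub>R v"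
    by (simp add: grad_cubic_model[OF grad_Rn[OF x] x v sym])
  also have "norm \<dots> \<le> norm (grad n f (x + v) - grad n f x - ?H) + norm (?B - ?H)
      + norm ((\<sigma> / 2 * norm v) *\<^sub>R v)"
    using norm_triangle_ineq4[of "grad n f (x + v) - grad n f x - ?H - (?B - ?H)"
        "(\<sigma> / 2 * norm v) *\<^sub>R v"]
      norm_triangle_ineq4[of "grad n f (x + v) - grad n f x - ?H" "?B - ?H"] by linarith
  also have "\<dots> \<le> L / 2 * norm v ^ 2 + e * norm v + \<sigma> / 2 * norm v ^ 2"
    using grad_taylor[OF x v] err[of v] \<sigma> by (simp add: power2_eq_square)
  finally show ?thesis by (simp add: field_simps)
qed

end

section \<open>Runs of M-CRM\<close>

text \<open>The index 1 always passes the test when \<open>\<sigma>\<^sub>1 \<le> \<sigma>\<close>,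
  so every inner loop starts at 0 or 1.\<close>

lemma first_inner:
  assumes "\<alpha> > 1" "0 < \<sigma>\<^sub>1" "\<sigma>\<^sub>1 \<le> \<sigma>"
  shows "first_inner \<alpha> \<sigma>\<^sub>1 \<sigma> \<le> 1" "\<alpha> powi (int (first_inner \<alpha> \<sigma>\<^sub>1 \<sigma>) - 1) * \<sigma> \<ge> \<sigma>\<^sub>1"
proof -
  have 1: "\<alpha> powi (int 1 - 1) * \<sigma> \<ge> \<sigma>\<^sub>1" using assms by simp
  show "first_inner \<alpha> \<sigma>\<^sub>1 \<sigma> \<le> 1" unfolding first_inner_def using 1 by (rule Least_le)
  show "\<alpha> powi (int (first_inner \<alpha> \<sigma>\<^sub>1 \<sigma>) - 1) * \<sigma> \<ge> \<sigma>\<^sub>1"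
    unfolding first_inner_def using 1 by (rule LeastI)
qed

text \<open>At least one of the two squares is \<ge> x, and its cube alone suffices.\<close>

lemma powr_le_sum_cubes:
  fixes a b x :: real
  assumes "0 \<le> a" "0 \<le> b" "0 \<le> x" "2 * x \<le> a ^ 2 + b ^ 2"
  shows "x powr (3/2) \<le> a ^ 3 + b ^ 3"
proof -
  have *: "x powr (3/2) \<le> c ^ 3" if "0 \<le> c" "x \<le> c ^ 2" for c
  proof (cases "c = 0")
    case False
    have "x powr (3/2) \<le> (c ^ 2) powr (3/2)" using that assms by (intro powr_mono2) auto
    also have "\<dots> = c ^ 3" using that False by (simp add: powr_powr flip: powr_numeral)
    finally show ?thesis .
  qed (use that assms in simp)
  show ?thesis
  proof (cases "x \<le> a ^ 2")
    case True
    with *[of a] assms show ?thesis by (simp add: add_increasing2)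
  next
    case False
    with assms *[of b] show ?thesis by (simp add: add_increasing)
  qed
qed

locale fd_mcrm_run =
  fixes n m :: nat and F :: "nat \<Rightarrow> evec \<Rightarrow> real" and L \<theta> \<sigma>\<^sub>1 \<alpha> \<beta> :: real
    and x\<^sub>0 x\<^sub>1 :: evec and c :: "mcrm_iter \<Rightarrow> nat \<Rightarrow> fd_scheme" and s :: "nat \<Rightarrow> mcrm_iter"
  assumes n: "n \<ge> 1" and m: "m \<ge> 1"
    and smooth: "\<And>j. j < m \<Longrightarrow> lipschitz_hessian n (F j) L"
    and \<beta>: "\<beta> \<le> 1/2"
    and run: "mcrm_run n m F (exact_grad n F) (fd_hess n F \<alpha> \<beta> c) \<theta> \<sigma>\<^sub>1 \<alpha> x\<^sub>0 x\<^sub>1 s"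
    and moving: "\<And>k. xcur (s k) \<noteq> xprev (s k)"
begin

definition N :: real where "N = real n powr (1/2 - \<beta>)"

definition prev_step :: "nat \<Rightarrow> real" where "prev_step k = norm (xcur (s k) - xprev (s k))"
definition step :: "nat \<Rightarrow> real" where "step k = norm (xtrial (s k) - xcur (s k))"
definition reg :: "nat \<Rightarrow> real" where "reg k = \<alpha> ^ inneridx (s k) * sigma (s k)"

lemma params: "\<sigma>\<^sub>1 > 0" "\<theta> \<ge> 0" "\<alpha> > 1"
  and start: "outer (s 0) = 1" "xprev (s 0) = x\<^sub>0" "xcur (s 0) = x\<^sub>1" "sigma (s 0) = \<sigma>\<^sub>1"
    "inneridx (s 0) = first_inner \<alpha> \<sigma>\<^sub>1 \<sigma>\<^sub>1"
  using run by (simp_all add: mcrm_run_def)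

lemma L_nonneg: "0 \<le> L"
  using lipschitz_hessian.lipschitz_const_nonneg[OF smooth n] m by auto

lemma N_ge_1: "1 \<le> N"
  unfolding N_def using n \<beta> by (intro ge_one_powr_ge_zero) auto

lemma steps_nonneg [simp]: "0 \<le> step k" "0 < prev_step k"
  using moving by (auto simp: step_def prev_step_def)

lemma powi_pred: "\<alpha> powi (int i - 1) = \<alpha> ^ i / \<alpha>"
  using params by (simp add: power_int_diff)

section \<open>Transitions of a run and elementary bounds on the regularization parameters\<close>

lemma accepted_step:
  assumes "accepted m F \<alpha> (s k)"
  shows "outer (s (Suc k)) = outer (s k) + 1" "xcur (s (Suc k)) = xtrial (s k)"
    "prev_step (Suc k) = step k" "sigma (s (Suc k)) = reg k / \<alpha>"
    "inneridx (s (Suc k)) = first_inner \<alpha> \<sigma>\<^sub>1 (sigma (s (Suc k)))"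
  using run assms by (auto simp: mcrm_run_def prev_step_def step_def reg_def powi_pred)

lemma rejected_step:
  assumes "\<not> accepted m F \<alpha> (s k)"
  shows "outer (s (Suc k)) = outer (s k)" "xcur (s (Suc k)) = xcur (s k)"
    "prev_step (Suc k) = prev_step k" "sigma (s (Suc k)) = sigma (s k)"
    "reg (Suc k) = \<alpha> * reg k"
  using run assms by (auto simp: mcrm_run_def prev_step_def reg_def)

lemma trial: "trial_ok n m (exact_grad n F) (fd_hess n F \<alpha> \<beta> c) \<theta> \<alpha> (s k)"
  using run by (simp add: mcrm_run_def)

lemma xtrial_Rn: "xtrial (s k) \<in> Rn n"
  using trial by (simp add: trial_ok_def Let_def)

lemma xcur_Rn: "xcur (s k) \<in> Rn n"
proof (induction k)
  case 0
  then show ?case using run by (simp add: mcrm_run_def)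
next
  case (Suc k)
  then show ?case
    using accepted_step(2)[of k] rejected_step(2)[of k] xtrial_Rn[of k] by metis
qed

text \<open>The two bounds sustain each other: after an acceptance the new \<open>sigma\<close> is
  \<open>reg\<close> divided by \<alpha>, and the starting rule for i then restores the bound on
  \<open>reg\<close>. A rejection only increases \<open>reg\<close>.\<close>

lemma reg_lower: "\<sigma>\<^sub>1 \<le> sigma (s k) \<and> \<alpha> * \<sigma>\<^sub>1 \<le> reg k"
proof (induction k)
  case 0
  then show ?case
    using first_inner(2)[of \<alpha> \<sigma>\<^sub>1 \<sigma>\<^sub>1] params
    by (simp add: start reg_def powi_pred field_simps)
next
  case (Suc k)
  show ?case
  proof (cases "accepted m F \<alpha> (s k)")
    case True
    have \<sigma>: "\<sigma>\<^sub>1 \<le> sigma (s (Suc k))"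
      using Suc params by (simp add: accepted_step[OF True] field_simps)
    with first_inner(2)[OF _ _ \<sigma>, of \<alpha>] params show ?thesis
      by (simp add: reg_def accepted_step(5)[OF True] powi_pred field_simps)
  next
    case False
    have "0 < \<alpha> * \<sigma>\<^sub>1" using params by simp
    with Suc have "0 \<le> reg k" by linarith
    then have "1 * reg k \<le> \<alpha> * reg k" using params by (intro mult_right_mono) auto
    with Suc show ?thesis by (simp add: rejected_step[OF False])
  qed
qed

lemma sigma_le_reg: "sigma (s k) \<le> reg k"
  using reg_lower[of k] params mult_right_mono[of 1 "\<alpha> ^ inneridx (s k)" "sigma (s k)"]
  by (simp add: reg_def)

text \<open>The next inner loop starts at index at most 1, and one factor \<alpha> merely undoes the
  division made by the acceptance.\<close>

lemma accepted_reg_upper: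
  assumes "accepted m F \<alpha> (s k)"
  shows "reg (Suc k) \<le> reg k"
proof -
  have \<sigma>: "\<sigma>\<^sub>1 \<le> sigma (s (Suc k))" using reg_lower by blast
  have "inneridx (s (Suc k)) \<le> 1"
    using first_inner(1)[OF _ _ \<sigma>] params by (simp add: accepted_step(5)[OF assms])
  then have "\<alpha> ^ inneridx (s (Suc k)) \<le> \<alpha>"
    using params power_increasing[of _ 1 \<alpha>] by simp
  then have "reg (Suc k) \<le> \<alpha> * sigma (s (Suc k))"
    unfolding reg_def using \<sigma> params by (intro mult_right_mono) auto
  then show ?thesis using params by (simp add: accepted_step(4)[OF assms])
qed

section \<open>Accuracy of the difference Hessians and the acceptance threshold\<close>

lemma fd_hess_error:
  assumes j: "j < m"
  shows "norm (mat_vec n (fd_hess n F \<alpha> \<beta> c (s k) j) v - mat_vec n (hess n (F j) (xcur (s k))) v)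
    \<le> \<alpha> * L * N * prev_step k / \<alpha> ^ inneridx (s k) * norm v"
proof -
  let ?h = "fd_step n \<alpha> \<beta> (s k)"
  have h: "?h = 2 * prev_step k / (real n powr \<beta> * (\<alpha> ^ inneridx (s k) / \<alpha>))"
    by (simp add: fd_step_def prev_step_def powi_pred)
  have pos: "?h > 0"
    unfolding h using n params by (intro divide_pos_pos mult_pos_pos) auto
  \<comment> \<open>The power of n in the difference step turns \<open>sqrt n\<close> into
    \<open>N\<close>, and the factor 2 in the step cancels the 1/2 of the column error.\<close>
  have "sqrt (real n) = N * real n powr \<beta>"
    using n by (simp add: N_def powr_half_sqrt flip: powr_add)
  then have "sqrt (real n) * (L * ?h / 2) = \<alpha> * L * N * prev_step k / \<alpha> ^ inneridx (s k)"
    unfolding h using n by simp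
  with lipschitz_hessian.symm_part_fd_matrix_error[OF smooth[OF j] xcur_Rn pos, of "c (s k) j" k v]
  show ?thesis by (simp only: fd_hess_def)
qed

text \<open>The factor 10 leaves enough slack: the model gains 1/6 of \<open>reg\<close> times the
  cubed step and loses at most 1/60 to the Taylor error and 1/20 to the Hessian error, so 1/10 \<ge>
  1/12 remains. The share 1/20 of the previous step is below the permitted 1/12.\<close>

lemma accepted_if_reg_large:
  assumes large: "10 * (\<alpha> * L * N) \<le> reg k"
  shows "accepted m F \<alpha> (s k)"
  unfolding accepted_def
proof (intro allI impI)
  fix j assume j: "j < m"
  let ?x = "xcur (s k)" and ?y = "xtrial (s k)" and ?q = "\<alpha> ^ inneridx (s k)"
  let ?P = "\<alpha> * L * N" and ?\<sigma> = "sigma (s k)" and ?r = "step k" and ?d = "prev_step k"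
  let ?M = "cubic_model n (grad n (F j) ?x) (fd_hess n F \<alpha> \<beta> c (s k) j) ?x (reg k) ?y"
  let ?A = "?P * ?d / ?q / 2 * ?r ^ 2"
  have q: "?q \<ge> 1" using params by simp
  have \<sigma>: "?\<sigma> > 0" using reg_lower[of k] params by linarith
  have r: "0 \<le> ?r" and d: "0 \<le> ?d" by (auto simp: less_imp_le)
  have "?M \<le> 0"
  proof (rule order_trans)
    let ?M = "\<lambda>j. cubic_model n (grad n (F j) ?x) (fd_hess n F \<alpha> \<beta> c (s k) j) ?x (reg k) ?y"
    show "?M j \<le> Max (?M ` {..<m})" using j by (intro Max_ge) auto
    show "Max (?M ` {..<m}) \<le> 0"
      using trial[of k] by (simp add: trial_ok_def Let_def exact_grad_def reg_def)
  qed
  moreover have "F j ?y - F j ?x \<le> ?M + ?A + (L * ?r ^ 3 / 6 - reg k * ?r ^ 3 / 6)"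
    using lipschitz_hessian.le_cubic_model[OF smooth[OF j] xcur_Rn Rn_diff[OF xtrial_Rn xcur_Rn]
      fd_hess_error[OF j], of k k k "reg k"]
    by (simp add: step_def diff_divide_distrib left_diff_distrib)
  moreover have "?A \<le> ?\<sigma> * ?d ^ 3 / 20 + ?\<sigma> * ?r ^ 3 / 20"
  proof -
    have dr: "?d * ?r ^ 2 \<le> ?d ^ 3 + ?r ^ 3"
    proof (cases "?d \<le> ?r")
      case True
      then have "?d * ?r ^ 2 \<le> ?r * ?r ^ 2" by (intro mult_right_mono) auto
      then show ?thesis using d by (simp add: power3_eq_cube power2_eq_square add_increasing)
    next
      case False
      then have "?d * ?r ^ 2 \<le> ?d * ?d ^ 2" using r d by (intro mult_left_mono power_mono) auto
      then show ?thesis using r by (simp add: power3_eq_cube power2_eq_square add_increasing2)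
    qed
    \<comment> \<open>Dividing the threshold by \<alpha>^i replaces \<open>reg\<close> by
      \<open>sigma\<close>: as the difference step shrinks with i, the error can be charged to the
      term weighted by \<open>sigma\<close>.\<close>
    have "?P / ?q \<le> ?\<sigma> / 10" using large q by (simp add: reg_def field_simps)
    then have "?P / ?q / 2 \<le> ?\<sigma> / 10 / 2" by (rule divide_right_mono) simp
    then have "?P / ?q / 2 \<le> ?\<sigma> / 20" by simp
    then have "?P / ?q / 2 * (?d * ?r ^ 2) \<le> ?\<sigma> / 20 * (?d ^ 3 + ?r ^ 3)"
      using dr by (rule mult_mono) (use \<sigma> d in auto)
    then show ?thesis by (simp add: distrib_left mult_ac)
  qed
  moreover have "L * ?r ^ 3 / 6 \<le> reg k * ?r ^ 3 / 60"
  proof -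
    have "L * 1 \<le> L * (\<alpha> * N)"
      using L_nonneg params N_ge_1 mult_mono[of 1 \<alpha> 1 N] by (intro mult_left_mono) auto
    then have "L / 6 \<le> reg k / 60" using large by (simp add: mult_ac)
    then have "L / 6 * ?r ^ 3 \<le> reg k / 60 * ?r ^ 3" using r by (intro mult_right_mono) auto
    then show ?thesis by simp
  qed
  moreover have "?\<sigma> * ?r ^ 3 \<le> reg k * ?r ^ 3"
    using sigma_le_reg r by (intro mult_right_mono) auto
  moreover have "0 \<le> ?\<sigma> * ?d ^ 3" "0 \<le> reg k * ?r ^ 3"
    using \<sigma> d r sigma_le_reg[of k] by auto
  ultimately have "F j ?x - F j ?y \<ge> reg k * ?r ^ 3 / 12 - ?\<sigma> * ?d ^ 3 / 12"
    by linarith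
  then show "F j ?x - F j ?y \<ge> ?q * ?\<sigma> / 12 * norm (?y - ?x) ^ 3
      - ?\<sigma> / 12 * norm (?x - xprev (s k)) ^ 3"
    by (simp add: reg_def step_def prev_step_def)
qed

section \<open>Upper bound on the regularization and the number of inner iterations\<close>

definition K :: real where "K = \<sigma>\<^sub>1 + 10 * \<alpha> * L"

lemma K_pos: "K > 0"
  using params L_nonneg by (simp add: K_def add_pos_nonneg)

text \<open>A rejection is possible only below the threshold, which is at most \<open>K * N\<close>,
  and raises \<open>reg\<close> by one factor \<alpha>. The summand \<open>\<sigma>\<^sub>1\<close>
  in \<open>K\<close> covers the start.\<close>

lemma reg_upper: "reg k \<le> \<alpha> * (K * N)"
proof (induction k)
  case 0
  have "\<alpha> ^ inneridx (s 0) \<le> \<alpha>"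
    using first_inner(1)[of \<alpha> \<sigma>\<^sub>1 \<sigma>\<^sub>1] params power_increasing[of _ 1 \<alpha>] by (simp add: start)
  then have "reg 0 \<le> \<alpha> * \<sigma>\<^sub>1"
    using params by (simp add: reg_def start)
  also have "\<sigma>\<^sub>1 \<le> K * N"
    using mult_mono[of \<sigma>\<^sub>1 K 1 N] params N_ge_1 L_nonneg K_pos by (simp add: K_def)
  finally show ?case using params by simp
next
  case (Suc k)
  show ?case
  proof (cases "accepted m F \<alpha> (s k)")
    case True
    then show ?thesis using accepted_reg_upper Suc by fastforce
  next
    case False
    then have "reg k \<le> 10 * (\<alpha> * L * N)" using accepted_if_reg_large[of k] by linarith
    also have "\<dots> \<le> K * N" using params N_ge_1 by (simp add: K_def algebra_simps)
    finally show ?thesis using params by (simp add: rejected_step[OF False])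
  qed
qed

text \<open>Here \<open>outer - 1\<close> is the number of acceptances so far. Each one enters the
  exponent twice: once as an iteration that is not a rejection, once for the factor \<alpha> that it
  may take from \<open>reg\<close>.\<close>

lemma regs_power_le: "\<sigma>\<^sub>1 * \<alpha> ^ k \<le> reg k * \<alpha> ^ (2 * (outer (s k) - 1)) \<and> 1 \<le> outer (s k)"
proof (induction k)
  case 0
  then show ?case using reg_lower[of 0] sigma_le_reg[of 0] by (simp add: start)
next
  case (Suc k)
  show ?case
  proof (cases "accepted m F \<alpha> (s k)")
    case True
    obtain o' where o: "outer (s k) = Suc o'" using Suc by (cases "outer (s k)") auto
    have "reg k / \<alpha> \<le> reg (Suc k)"
      using sigma_le_reg[of "Suc k"] by (simp add: accepted_step[OF True])
    then have "reg k \<le> \<alpha> * reg (Suc k)" using params by (simp add: field_simps)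
    then have "\<alpha> * (reg k * \<alpha> ^ (2 * o')) \<le> \<alpha> * ((\<alpha> * reg (Suc k)) * \<alpha> ^ (2 * o'))"
      using params by (intro mult_left_mono mult_right_mono) auto
    moreover have "\<alpha> * (\<sigma>\<^sub>1 * \<alpha> ^ k) \<le> \<alpha> * (reg k * \<alpha> ^ (2 * o'))"
      using Suc params o by (intro mult_left_mono) auto
    ultimately show ?thesis
      by (simp add: accepted_step[OF True] o mult_ac)
  next
    case False
    have "\<alpha> * (\<sigma>\<^sub>1 * \<alpha> ^ k) \<le> \<alpha> * (reg k * \<alpha> ^ (2 * (outer (s k) - 1)))"
      using Suc params by (intro mult_left_mono) auto
    then show ?thesis using Suc by (simp add: rejected_step[OF False] mult_ac)
  qed
qed

lemma inner_iterations_le: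
  "real k \<le> 2 * real (outer (s k) - 1) + \<alpha> * K / (\<sigma>\<^sub>1 * ln \<alpha>) * N"
proof -
  let ?o = "2 * (outer (s k) - 1)" and ?z = "\<alpha> * K * N / \<sigma>\<^sub>1"
  have z: "?z > 0" using params K_pos N_ge_1 by simp
  have "reg k * \<alpha> ^ ?o \<le> \<alpha> * (K * N) * \<alpha> ^ ?o"
    using params by (intro mult_right_mono reg_upper) auto
  with regs_power_le[of k] have "\<sigma>\<^sub>1 * \<alpha> ^ k \<le> \<alpha> * (K * N) * \<alpha> ^ ?o" by linarith
  then have "\<alpha> ^ k \<le> ?z * \<alpha> ^ ?o"
    using params by (simp add: field_simps)
  then have "ln (\<alpha> ^ k) \<le> ln (?z * \<alpha> ^ ?o)"
    using params z by (intro ln_mono) auto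
  also have "\<dots> = ln ?z + real ?o * ln \<alpha>"
    using params z by (subst ln_mult) (auto simp: ln_realpow)
  also have "ln ?z \<le> ?z" using z by (rule ln_bound)
  finally have "real k * ln \<alpha> \<le> real ?o * ln \<alpha> + ?z"
    using params by (simp add: ln_realpow)
  then have "real k \<le> (real ?o * ln \<alpha> + ?z) / ln \<alpha>"
    using params by (simp add: pos_le_divide_eq)
  also have "\<dots> = real ?o + ?z / ln \<alpha>"
    using params by (simp add: add_divide_distrib)
  finally show ?thesis by simp
qed

section \<open>Criticality of trial points in terms of the step lengths\<close>

definition G :: real where "G = \<theta> + (L + \<alpha> * K + \<alpha> * L) / 2"

lemma G_pos: "G > 0"
proof -
  have "0 < L + \<alpha> * K" using params K_pos L_nonneg by (intro add_nonneg_pos) auto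
  then have "0 < (L + \<alpha> * K + \<alpha> * L) / 2" using params L_nonneg by (simp add: add_pos_nonneg)
  then show ?thesis unfolding G_def using params by (intro add_nonneg_pos)
qed

text \<open>The multipliers of the model are reused for the objectives. In \<open>G\<close>,
  \<theta> stems from inexact stationarity, (L + \<alpha> K) / 2 from the Taylor and cubic terms,
  and \<alpha> L / 2 from the Hessian error after 2 d r \<le> d^2 + r^2.\<close>

lemma multiplier_grad_le:
  "norm (\<Sum>j<m. ltrial (s k) j *\<^sub>R grad n (F j) (xtrial (s k)))
    \<le> G * N * (step k ^ 2 + prev_step k ^ 2)"
proof -
  let ?x = "xcur (s k)" and ?y = "xtrial (s k)" and ?l = "ltrial (s k)"
  let ?r = "step k" and ?d = "prev_step k" and ?P = "\<alpha> * L * N"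
  let ?M = "\<lambda>j. cubic_model n (grad n (F j) ?x) (fd_hess n F \<alpha> \<beta> c (s k) j) ?x (reg k)"
  let ?e = "(L + reg k) / 2 * ?r ^ 2 + ?P * ?d * ?r"
  have l: "in_simplex m ?l"
    and stat: "norm (\<Sum>j<m. ?l j *\<^sub>R grad n (?M j) ?y) \<le> \<theta> * ?r ^ 2"
    using trial[of k] by (auto simp: trial_ok_def Let_def exact_grad_def reg_def step_def)
  have reg: "0 \<le> reg k" using reg_lower[of k] params sigma_le_reg[of k] by linarith
  have P: "0 \<le> ?P" using params L_nonneg N_ge_1 by simp
  have r: "0 \<le> ?r" and d: "0 \<le> ?d" by (auto simp: less_imp_le)
  have diff: "norm (grad n (F j) ?y - grad n (?M j) ?y) \<le> ?e" if j: "j < m" for j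
  proof -
    have "norm (grad n (F j) ?y - grad n (?M j) ?y)
        \<le> (L + reg k) / 2 * ?r ^ 2 + ?P * ?d / \<alpha> ^ inneridx (s k) * ?r"
      using lipschitz_hessian.norm_grad_diff_cubic_model_le[OF smooth[OF j] xcur_Rn
        Rn_diff[OF xtrial_Rn xcur_Rn] reg _ fd_hess_error[OF j], of k k k]
      by (simp add: step_def fd_hess_def symm_part_def add.commute)
    also have "?P * ?d / \<alpha> ^ inneridx (s k) * ?r \<le> ?P * ?d * ?r"
      using params P r d divide_left_mono[of 1 "\<alpha> ^ inneridx (s k)" "?P * ?d"]
      by (intro mult_right_mono) auto
    finally show ?thesis by simp
  qed
  have split: "(\<Sum>j<m. ?l j *\<^sub>R grad n (F j) ?y)
      = (\<Sum>j<m. ?l j *\<^sub>R grad n (?M j) ?y) + (\<Sum>j<m. ?l j *\<^sub>R (grad n (F j) ?y - grad n (?M j) ?y))"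
    by (simp add: scaleR_diff_right sum_subtractf)
  have "norm (\<Sum>j<m. ?l j *\<^sub>R grad n (F j) ?y) \<le> \<theta> * ?r ^ 2 + (\<Sum>j<m. ?l j * ?e)"
    unfolding split
  proof (rule norm_triangle_mono[OF stat], rule order_trans[OF norm_sum], rule sum_mono)
    fix j assume j: "j \<in> {..<m}"
    then have "0 \<le> ?l j" using l by (simp add: in_simplex_def)
    then show "norm (?l j *\<^sub>R (grad n (F j) ?y - grad n (?M j) ?y)) \<le> ?l j * ?e"
      using diff j by (simp add: mult_left_mono)
  qed
  also have "\<dots> = \<theta> * ?r ^ 2 + ?e"
  proof -
    have "(\<Sum>j<m. ?l j * ?e) = (\<Sum>j<m. ?l j) * ?e" by (rule sum_distrib_right[symmetric])
    then show ?thesis using l by (simp only: in_simplex_def mult_1)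
  qed
  also have "\<dots> \<le> G * N * (?r ^ 2 + ?d ^ 2)"
  proof -
    have "?P * ?d * ?r \<le> ?P / 2 * (?r ^ 2 + ?d ^ 2)"
      using mult_left_mono[OF sum_squares_bound[of ?d ?r] P] by (simp add: algebra_simps)
    moreover have "(\<theta> + (L + reg k) / 2) * ?r ^ 2 \<le> (\<theta> + (L + reg k) / 2) * (?r ^ 2 + ?d ^ 2)"
      using params L_nonneg reg by (intro mult_left_mono) auto
    moreover have "(\<theta> + (L + reg k) / 2 + ?P / 2) * (?r ^ 2 + ?d ^ 2) \<le> G * N * (?r ^ 2 + ?d ^ 2)"
    proof (rule mult_right_mono)
      have "\<theta> \<le> \<theta> * N" "L \<le> L * N"
        using params L_nonneg N_ge_1 by (simp_all add: mult_le_cancel_left1)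
      with reg_upper[of k] show "\<theta> + (L + reg k) / 2 + ?P / 2 \<le> G * N"
        by (simp add: G_def algebra_simps add_divide_distrib)
    qed simp
    ultimately show ?thesis unfolding distrib_right[of _ "?P / 2"] distrib_right[of \<theta> _ "?r ^ 2"]
      by linarith
  qed
  finally show ?thesis .
qed

text \<open>A rejected trial point never becomes an iterate, so a critical point counts as generated
  only upon acceptance.\<close>

definition stops :: "real \<Rightarrow> nat \<Rightarrow> bool" where
  "stops \<epsilon> k \<longleftrightarrow> accepted m F \<alpha> (s k) \<and> approx_pareto_critical n m F \<epsilon> (xtrial (s k))"

text \<open>Otherwise \<open>ltrial\<close> would certify criticality. The 2 in the denominator pays
  for selecting the larger of two squares.\<close>

lemma noncritical_step_large:
  assumes "accepted m F \<alpha> (s k)" "\<not> stops \<epsilon> k" "0 \<le> \<epsilon>"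
  shows "(\<epsilon> / (2 * G * N)) powr (3/2) \<le> step k ^ 3 + prev_step k ^ 3"
proof (rule powr_le_sum_cubes)
  have GN: "G * N > 0" using G_pos N_ge_1 by simp
  have "in_simplex m (ltrial (s k))"
    using trial[of k] by (simp add: trial_ok_def Let_def)
  then have "\<epsilon> \<le> G * N * (step k ^ 2 + prev_step k ^ 2)"
    using multiplier_grad_le[of k] assms xtrial_Rn[of k]
    by (force simp: stops_def approx_pareto_critical_def)
  then show "2 * (\<epsilon> / (2 * G * N)) \<le> step k ^ 2 + prev_step k ^ 2"
    using GN by (simp add: divide_le_eq mult_ac)
qed (use assms G_pos N_ge_1 in \<open>auto simp: less_imp_le\<close>)

section \<open>A potential that decreases along accepted steps\<close>

definition \<gamma> :: real where "\<gamma> = (\<alpha> - 1) / 24"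

text \<open>The weight 1/12 compensates the increase that Step 1.3 tolerates; the additional
  \<gamma> pays for the cube of the previous step.\<close>

definition potential :: "nat \<Rightarrow> nat \<Rightarrow> real" where
  "potential j k = F j (xcur (s k)) + (1/12 + \<gamma>) * sigma (s k) * prev_step k ^ 3"

lemma potential_accepted:
  assumes acc: "accepted m F \<alpha> (s k)" and j: "j < m"
  shows "potential j (Suc k) + \<gamma> * \<sigma>\<^sub>1 * (step k ^ 3 + prev_step k ^ 3) \<le> potential j k"
proof -
  let ?r = "step k ^ 3" and ?d = "prev_step k ^ 3" and ?\<sigma>' = "sigma (s (Suc k))"
  have \<gamma>: "0 \<le> \<gamma>" using params by (simp add: \<gamma>_def)
  have reg: "reg k = \<alpha> * ?\<sigma>'" using params by (simp add: accepted_step(4)[OF acc])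
  have "F j (xtrial (s k)) \<le> F j (xcur (s k)) - reg k / 12 * ?r + sigma (s k) / 12 * ?d"
    using acc j by (force simp: accepted_def reg_def step_def prev_step_def)
  moreover have "\<gamma> * \<sigma>\<^sub>1 * ?r \<le> \<gamma> * ?\<sigma>' * ?r" "\<gamma> * \<sigma>\<^sub>1 * ?d \<le> \<gamma> * sigma (s k) * ?d"
    using \<gamma> reg_lower by (auto intro!: mult_right_mono mult_left_mono simp: less_imp_le)
  \<comment> \<open>Beyond the 1/12 carried into the next potential, a surplus (\<alpha> - 1) / 12 =
    2 \<gamma> remains: one \<gamma> goes into the next potential, the other pays for the current
    step.\<close>
  moreover have "reg k / 12 * ?r = ?\<sigma>' * ?r / 12 + 2 * (\<gamma> * ?\<sigma>' * ?r)"
    unfolding reg \<gamma>_def by (simp add: field_simps)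
  moreover have "potential j k = F j (xcur (s k)) + sigma (s k) / 12 * ?d + \<gamma> * sigma (s k) * ?d"
    "potential j (Suc k) = F j (xtrial (s k)) + ?\<sigma>' * ?r / 12 + \<gamma> * ?\<sigma>' * ?r"
    by (simp_all add: potential_def accepted_step(2,3)[OF acc] distrib_right)
  ultimately show ?thesis
    unfolding distrib_left by linarith
qed

text \<open>Telescoping; a rejection changes none of the quantities in the potential.\<close>

lemma potential_sum:
  assumes j: "j < m"
  shows "potential j k + \<gamma> * \<sigma>\<^sub>1 *
    (\<Sum>i | i < k \<and> accepted m F \<alpha> (s i). step i ^ 3 + prev_step i ^ 3) \<le> potential j 0"
proof (induction k)
  case (Suc k)
  show ?case
  proof (cases "accepted m F \<alpha> (s k)")
    case True
    then have "{i. i < Suc k \<and> accepted m F \<alpha> (s i)} = insert k {i. i < k \<and> accepted m F \<alpha> (s i)}"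
      by (auto simp: less_Suc_eq)
    with Suc potential_accepted[OF True j] show ?thesis by (simp add: distrib_left)
  next
    case False
    then have "{i. i < Suc k \<and> accepted m F \<alpha> (s i)} = {i. i < k \<and> accepted m F \<alpha> (s i)}"
      by (auto simp: less_Suc_eq)
    with Suc show ?thesis by (simp add: potential_def rejected_step[OF False])
  qed
qed simp

lemma outer_eq: "outer (s k) = 1 + card {i. i < k \<and> accepted m F \<alpha> (s i)}"
proof (induction k)
  case (Suc k)
  show ?case
  proof (cases "accepted m F \<alpha> (s k)")
    case True
    then have "{i. i < Suc k \<and> accepted m F \<alpha> (s i)} = insert k {i. i < k \<and> accepted m F \<alpha> (s i)}"
      by (auto simp: less_Suc_eq)
    with Suc show ?thesis by (simp add: accepted_step[OF True])
  next
    case False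
    then have "{i. i < Suc k \<and> accepted m F \<alpha> (s i)} = {i. i < k \<and> accepted m F \<alpha> (s i)}"
      by (auto simp: less_Suc_eq)
    with Suc show ?thesis by (simp add: rejected_step[OF False])
  qed
qed (simp add: start)

section \<open>Complexity bounds for a single run\<close>

lemma outer_iterations_le:
  assumes j: "j < m" and bnd: "\<And>y. y \<in> Rn n \<Longrightarrow> Fstar \<le> F j y"
    and \<epsilon>: "0 < \<epsilon>" and none: "\<And>i. i < k \<Longrightarrow> \<not> stops \<epsilon> i"
  shows "real (outer (s k) - 1) \<le> (F j x\<^sub>1 - Fstar + (1/12 + \<gamma>) * \<sigma>\<^sub>1 * norm (x\<^sub>1 - x\<^sub>0) ^ 3)
    / (\<gamma> * \<sigma>\<^sub>1) * (2 * G) powr (3/2) * (N powr (3/2) * \<epsilon> powr (- 3/2))"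
proof -
  let ?A = "{i. i < k \<and> accepted m F \<alpha> (s i)}" and ?p = "(\<epsilon> / (2 * G * N)) powr (3/2)"
  have \<gamma>: "0 < \<gamma>" using params by (simp add: \<gamma>_def)
  have "Fstar \<le> potential j k"
    using bnd[OF xcur_Rn[of k]] \<gamma> reg_lower[of k] params
    by (simp add: potential_def add_increasing2 less_imp_le)
  \<comment> \<open>Every acceptance before \<open>k\<close> produced a noncritical point, so each
    summand is at least \<open>?p\<close>.\<close>
  moreover have "real (card ?A) * ?p \<le> (\<Sum>i\<in>?A. step i ^ 3 + prev_step i ^ 3)"
    using noncritical_step_large none \<epsilon> by (intro sum_bounded_below) auto
  then have "\<gamma> * \<sigma>\<^sub>1 * (real (card ?A) * ?p)
      \<le> \<gamma> * \<sigma>\<^sub>1 * (\<Sum>i\<in>?A. step i ^ 3 + prev_step i ^ 3)"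
    using \<gamma> params by (intro mult_left_mono) auto
  ultimately have "\<gamma> * \<sigma>\<^sub>1 * (real (card ?A) * ?p) \<le> potential j 0 - Fstar"
    using potential_sum[OF j, of k] by linarith
  then have "real (card ?A) * ?p \<le> (potential j 0 - Fstar) / (\<gamma> * \<sigma>\<^sub>1)"
    using \<gamma> params by (simp add: pos_le_divide_eq mult_ac)
  moreover have "?p > 0" using \<epsilon> G_pos N_ge_1 by simp
  ultimately have "real (card ?A) \<le> (potential j 0 - Fstar) / (\<gamma> * \<sigma>\<^sub>1) / ?p"
    by (simp only: pos_le_divide_eq)
  also have "1 / ?p = (2 * G) powr (3/2) * (N powr (3/2) * \<epsilon> powr (- 3/2))"
    using \<epsilon> G_pos N_ge_1 by (simp add: powr_divide powr_mult powr_minus_divide)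
  then have "(potential j 0 - Fstar) / (\<gamma> * \<sigma>\<^sub>1) / ?p = (potential j 0 - Fstar) / (\<gamma> * \<sigma>\<^sub>1)
      * ((2 * G) powr (3/2) * (N powr (3/2) * \<epsilon> powr (- 3/2)))"
    by (metis mult.right_neutral times_divide_eq_right)
  also have "potential j 0 - Fstar = F j x\<^sub>1 - Fstar + (1/12 + \<gamma>) * \<sigma>\<^sub>1 * norm (x\<^sub>1 - x\<^sub>0) ^ 3"
    by (simp add: potential_def start prev_step_def)
  finally show ?thesis
    by (simp add: outer_eq mult.assoc)
qed

text \<open>While no stop has occurred, the number of inner iterations is bounded; hence a stop
  occurs, and in particular no inner loop before it runs forever. The bounds are then read off at
  the first stop.\<close>

lemma stops_within_bounds:
  assumes j: "j < m" and bnd: "\<And>y. y \<in> Rn n \<Longrightarrow> Fstar \<le> F j y" and \<epsilon>: "0 < \<epsilon>" "\<epsilon> \<le> 1"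
  defines "A \<equiv> (F j x\<^sub>1 - Fstar + (1/12 + \<gamma>) * \<sigma>\<^sub>1 * norm (x\<^sub>1 - x\<^sub>0) ^ 3) / (\<gamma> * \<sigma>\<^sub>1) * (2 * G) powr (3/2)"
    and "B \<equiv> \<alpha> * K / (\<sigma>\<^sub>1 * ln \<alpha>)"
    and "X \<equiv> real n powr (3 * (1 - 2 * \<beta>) / 4) * \<epsilon> powr (- 3/2)"
  shows "\<exists>k. stops \<epsilon> k \<and> real (outer (s k)) \<le> (1 + A) * X \<and> real (Suc k) \<le> (1 + 2 * A + B) * X"
proof -
  have NX: "N powr (3/2) * \<epsilon> powr (- 3/2) = X"
  proof -
    have "(1/2 - \<beta>) * (3/2) = 3 * (1 - 2 * \<beta>) / 4" by (simp add: field_simps)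
    then show ?thesis by (simp only: N_def X_def powr_powr)
  qed
  \<comment> \<open>As \<open>N\<close> \<ge> 1 and \<epsilon> \<le> 1, both \<open>N\<close> and
    additive constants are absorbed by \<open>X\<close>.\<close>
  have "1 \<le> \<epsilon> powr (- 3/2)"
    using \<epsilon> by (simp add: powr_minus_divide powr_le1)
  moreover have "N powr 1 \<le> N powr (3/2)" using N_ge_1 by (intro powr_mono) auto
  then have "N \<le> N powr (3/2)" using N_ge_1 by simp
  ultimately have "N * 1 \<le> X"
    unfolding NX[symmetric] using N_ge_1 by (intro mult_mono) auto
  then have X: "N \<le> X" "1 \<le> X" using N_ge_1 by auto
  have B: "0 \<le> B" unfolding B_def using params K_pos by simp
  \<comment> \<open>Only indices below \<open>k\<close> must be free of stops, so this applies at
    the first stop itself. The summands 1 account for \<open>outer\<close> starting at 1 and for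
    inner iterations being numbered from 0.\<close>
  have bounds: "real (outer (s k)) \<le> (1 + A) * X \<and> real (Suc k) \<le> (1 + 2 * A + B) * X"
    if none: "\<And>i. i < k \<Longrightarrow> \<not> stops \<epsilon> i" for k
  proof -
    have "real (outer (s k) - 1) \<le> A * X"
      using outer_iterations_le[OF j bnd \<epsilon>(1) none] unfolding A_def NX by simp
    moreover have "real k \<le> 2 * real (outer (s k) - 1) + B * N"
      using inner_iterations_le unfolding B_def .
    moreover have "B * N \<le> B * X" using X B by (intro mult_left_mono)
    moreover have "1 \<le> outer (s k)" using regs_power_le by blast
    ultimately show ?thesis using X by (simp add: distrib_right of_nat_diff)
  qed
  have "\<exists>k. stops \<epsilon> k"
  proof (rule ccontr)
    assume "\<nexists>k. stops \<epsilon> k"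
    then have "real (Suc k) \<le> (1 + 2 * A + B) * X" for k using bounds by blast
    moreover obtain k where "(1 + 2 * A + B) * X < real k" using reals_Archimedean2 by blast
    ultimately show False by (metis lessI less_trans not_le of_nat_less_iff)
  qed
  then have "stops \<epsilon> (LEAST k. stops \<epsilon> k)" by (rule LeastI_ex)
  with bounds[OF not_less_Least[of _ "stops \<epsilon>"]] show ?thesis by blast
qed

lemma total_evals_le: "real (total_evals n m c s k) \<le> 5 * real n * real m * real (Suc k)"
proof -
  have "inner_evals n m c t \<le> m * (5 * n)" for t
  proof -
    \<comment> \<open>The worst case is the central scheme: 3 + 2 n \<le> 5 n since n \<ge>
      1.\<close>
    have "1 + shifted_grad_evals n (c t j) + 2 \<le> 5 * n" for j
      using n by (cases "c t j") auto
    then have "inner_evals n m c t \<le> (\<Sum>j<m. 5 * n)"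
      unfolding inner_evals_def by (intro sum_mono)
    then show ?thesis by simp
  qed
  then have "total_evals n m c s k \<le> (\<Sum>k'\<le>k. m * (5 * n))"
    unfolding total_evals_def by (intro sum_mono)
  then have "total_evals n m c s k \<le> Suc k * (m * (5 * n))" by simp
  then have "real (total_evals n m c s k) \<le> real (Suc k * (m * (5 * n)))"
    by (simp only: of_nat_le_iff)
  then show ?thesis by (simp add: mult_ac)
qed

end

section \<open>Uniformity of the constants and the evaluation count\<close>

theorem mainTheorem2:
  "\<exists>C\<^sub>1 C\<^sub>2 :: real \<Rightarrow> real \<Rightarrow> real \<Rightarrow> real \<Rightarrow> real \<Rightarrow> real \<Rightarrow> real.
     \<forall>(n :: nat) (m :: nat) (F :: nat \<Rightarrow> evec \<Rightarrow> real) (Lip :: nat \<Rightarrow> real) (Fstar :: nat \<Rightarrow> real)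
       (\<theta> :: real) (\<sigma>\<^sub>1 :: real) (\<alpha> :: real) (\<beta> :: real) (x\<^sub>0 :: evec) (x\<^sub>1 :: evec)
       (c :: mcrm_iter \<Rightarrow> nat \<Rightarrow> fd_scheme) (s :: nat \<Rightarrow> mcrm_iter) (\<epsilon> :: real).
       n \<ge> 1 \<and> m \<ge> 1 \<and>
       (\<forall>j<m. C2_on_Rn n (F j)) \<and>
       (\<forall>j<m. \<forall>y\<in>Rn n. \<forall>z\<in>Rn n.
          mat_dist n (hess n (F j) y) (hess n (F j) z) \<le> Lip j * norm (y - z)) \<and>
       (\<forall>j<m. \<forall>y\<in>Rn n. F j y \<ge> Fstar j) \<and>
       0 \<le> \<beta> \<and> \<beta> \<le> 1/2 \<and>
       mcrm_run n m F (exact_grad n F) (fd_hess n F \<alpha> \<beta> c) \<theta> \<sigma>\<^sub>1 \<alpha> x\<^sub>0 x\<^sub>1 s \<and>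
       (\<forall>k. xcur (s k) \<noteq> xprev (s k)) \<and>
       0 < \<epsilon> \<and> \<epsilon> \<le> 1
       \<longrightarrow>
       (let L = Max (Lip ` {..<m});
            \<Delta> = Min ((\<lambda>j. F j x\<^sub>1 - Fstar j) ` {..<m});
            D = norm (x\<^sub>1 - x\<^sub>0)
        in \<exists>k. accepted m F \<alpha> (s k) \<and>
               approx_pareto_critical n m F \<epsilon> (xtrial (s k)) \<and>
               real (outer (s k))
                 \<le> C\<^sub>1 L \<theta> \<sigma>\<^sub>1 \<alpha> \<Delta> D * real n powr (3 * (1 - 2 * \<beta>) / 4) * \<epsilon> powr (- 3/2) \<and>
               real (total_evals n m c s k)
                 \<le> C\<^sub>2 L \<theta> \<sigma>\<^sub>1 \<alpha> \<Delta> D * real m * real n powr ((7 - 6 * \<beta>) / 4) * \<epsilon> powr (- 3/2))"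
proof -
  \<comment> \<open>The constants must be fixed before n, m and \<epsilon>, so those of the locale
    are restated as functions of the admissible parameters alone.\<close>
  define K' where "K' = (\<lambda>L \<sigma>\<^sub>1 \<alpha>. \<sigma>\<^sub>1 + 10 * \<alpha> * L :: real)"
  define G' where "G' = (\<lambda>L \<theta> \<sigma>\<^sub>1 \<alpha>. \<theta> + (L + \<alpha> * K' L \<sigma>\<^sub>1 \<alpha> + \<alpha> * L) / 2)"
  define A' where "A' = (\<lambda>L \<theta> \<sigma>\<^sub>1 \<alpha> \<Delta> D. (\<Delta> + (1/12 + (\<alpha> - 1) / 24) * \<sigma>\<^sub>1 * D ^ 3)
    / ((\<alpha> - 1) / 24 * \<sigma>\<^sub>1) * (2 * G' L \<theta> \<sigma>\<^sub>1 \<alpha>) powr (3/2))"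
  define B' where "B' = (\<lambda>L \<sigma>\<^sub>1 \<alpha>. \<alpha> * K' L \<sigma>\<^sub>1 \<alpha> / (\<sigma>\<^sub>1 * ln \<alpha>))"
  show ?thesis
  proof (rule exI[of _ "\<lambda>L \<theta> \<sigma>\<^sub>1 \<alpha> \<Delta> D. 1 + A' L \<theta> \<sigma>\<^sub>1 \<alpha> \<Delta> D"],
      rule exI[of _ "\<lambda>L \<theta> \<sigma>\<^sub>1 \<alpha> \<Delta> D. 5 * (1 + 2 * A' L \<theta> \<sigma>\<^sub>1 \<alpha> \<Delta> D + B' L \<sigma>\<^sub>1 \<alpha>)"],
      intro allI impI, elim conjE)
    fix n m :: nat and F :: "nat \<Rightarrow> evec \<Rightarrow> real" and Lip Fstar :: "nat \<Rightarrow> real"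
      and \<theta> \<sigma>\<^sub>1 \<alpha> \<beta> :: real and x\<^sub>0 x\<^sub>1 :: evec and c :: "mcrm_iter \<Rightarrow> nat \<Rightarrow> fd_scheme"
      and s :: "nat \<Rightarrow> mcrm_iter" and \<epsilon> :: real
    assume n: "n \<ge> 1" and m: "m \<ge> 1"
      and C2: "\<forall>j<m. C2_on_Rn n (F j)"
      and lip: "\<forall>j<m. \<forall>y\<in>Rn n. \<forall>z\<in>Rn n.
        mat_dist n (hess n (F j) y) (hess n (F j) z) \<le> Lip j * norm (y - z)"
      and bnd: "\<forall>j<m. \<forall>y\<in>Rn n. F j y \<ge> Fstar j"
      and \<beta>: "\<beta> \<le> 1/2"
      and run: "mcrm_run n m F (exact_grad n F) (fd_hess n F \<alpha> \<beta> c) \<theta> \<sigma>\<^sub>1 \<alpha> x\<^sub>0 x\<^sub>1 s"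
      and moving: "\<forall>k. xcur (s k) \<noteq> xprev (s k)"
      and \<epsilon>: "0 < \<epsilon>" "\<epsilon> \<le> 1"
    define L where "L = Max (Lip ` {..<m})"
    define \<Delta> where "\<Delta> = Min ((\<lambda>j. F j x\<^sub>1 - Fstar j) ` {..<m})"
    define D where "D = norm (x\<^sub>1 - x\<^sub>0)"
    have smooth: "lipschitz_hessian n (F j) L" if j: "j < m" for j
    proof
      show "C2_on_Rn n (F j)" using C2 j by blast
      fix y z assume "y \<in> Rn n" "z \<in> Rn n"
      then have "mat_dist n (hess n (F j) y) (hess n (F j) z) \<le> Lip j * norm (y - z)"
        using lip j by blast
      also have "\<dots> \<le> L * norm (y - z)"
        unfolding L_def using j by (intro mult_right_mono Max_ge) auto
      finally show "mat_dist n (hess n (F j) y) (hess n (F j) z) \<le> L * norm (y - z)" .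
    qed
    interpret fd_mcrm_run n m F L \<theta> \<sigma>\<^sub>1 \<alpha> \<beta> x\<^sub>0 x\<^sub>1 c s
      by (rule fd_mcrm_run.intro) (use n m smooth \<beta> run moving in auto)
    \<comment> \<open>The iteration bound needs the gap of just one objective, so one attaining the
      minimum is chosen.\<close>
    have "\<Delta> \<in> (\<lambda>j. F j x\<^sub>1 - Fstar j) ` {..<m}"
      unfolding \<Delta>_def using m by (intro Min_in) (auto simp: lessThan_empty_iff)
    then obtain j where j: "j < m" and \<Delta>: "F j x\<^sub>1 - Fstar j = \<Delta>" by auto
    let ?A = "A' L \<theta> \<sigma>\<^sub>1 \<alpha> \<Delta> D" and ?B = "B' L \<sigma>\<^sub>1 \<alpha>"
    let ?X = "real n powr (3 * (1 - 2 * \<beta>) / 4) * \<epsilon> powr (- 3/2)"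
    obtain k where k: "stops \<epsilon> k" "real (outer (s k)) \<le> (1 + ?A) * ?X"
      "real (Suc k) \<le> (1 + 2 * ?A + ?B) * ?X"
      using stops_within_bounds[OF j _ \<epsilon>, of "Fstar j"] bnd j
      by (auto simp: A'_def B'_def G'_def K'_def \<gamma>_def G_def K_def \<Delta> D_def)
    \<comment> \<open>The extra factor n is the cost of the difference matrix in one inner
      iteration.\<close>
    have "real n * real n powr (3 * (1 - 2 * \<beta>) / 4) = real n powr ((7 - 6 * \<beta>) / 4)"
    proof -
      have "real n * real n powr (3 * (1 - 2 * \<beta>) / 4) = real n powr (1 + 3 * (1 - 2 * \<beta>) / 4)"
        using n by (simp add: powr_add)
      also have "1 + 3 * (1 - 2 * \<beta>) / 4 = (7 - 6 * \<beta>) / 4" by (simp add: field_simps)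
      finally show ?thesis .
    qed
    moreover have "real (total_evals n m c s k)
        \<le> 5 * real n * real m * ((1 + 2 * ?A + ?B) * ?X)"
      using total_evals_le[of k] k(3) mult_left_mono[of _ _ "5 * real n * real m"]
      by (meson mult_nonneg_nonneg of_nat_0_le_iff order_trans zero_le_numeral)
    moreover have "5 * real n * real m * ((1 + 2 * ?A + ?B) * ?X) = 5 * (1 + 2 * ?A + ?B) * real m
        * (real n * real n powr (3 * (1 - 2 * \<beta>) / 4)) * \<epsilon> powr (- 3/2)"
      by (simp only: mult_ac)
    ultimately have "real (total_evals n m c s k)
        \<le> 5 * (1 + 2 * ?A + ?B) * real m * real n powr ((7 - 6 * \<beta>) / 4) * \<epsilon> powr (- 3/2)"
      by (simp only:)
    moreover have "real (outer (s k))
        \<le> (1 + ?A) * real n powr (3 * (1 - 2 * \<beta>) / 4) * \<epsilon> powr (- 3/2)"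
      using k(2) by (simp only: mult.assoc)
    ultimately show "let L = Max (Lip ` {..<m}); \<Delta> = Min ((\<lambda>j. F j x\<^sub>1 - Fstar j) ` {..<m});
        D = norm (x\<^sub>1 - x\<^sub>0)
      in \<exists>k. accepted m F \<alpha> (s k) \<and> approx_pareto_critical n m F \<epsilon> (xtrial (s k)) \<and>
        real (outer (s k)) \<le> (1 + A' L \<theta> \<sigma>\<^sub>1 \<alpha> \<Delta> D) * real n powr (3 * (1 - 2 * \<beta>) / 4) * \<epsilon> powr (- 3/2) \<and>
        real (total_evals n m c s k) \<le> 5 * (1 + 2 * A' L \<theta> \<sigma>\<^sub>1 \<alpha> \<Delta> D + B' L \<sigma>\<^sub>1 \<alpha>) * real m
          * real n powr ((7 - 6 * \<beta>) / 4) * \<epsilon> powr (- 3/2)"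
      using k(1) unfolding Let_def L_def[symmetric] \<Delta>_def[symmetric] D_def[symmetric] stops_def
      by blast
  qed
qed

end
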